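(* Let $\mathbf{F}_q$ be a finite field and let $M\in\mathrm{Mat}_n(\mathbf{F}_q)$ have part-size invariant $k$. The determinants which occur in the centralizer of $M$ in $\mathrm{Mat}_n(\mathbf{F}_q)$ are precisely the $k$-th powers in $\mathbf{F}_q$; that is, $\{\det Y : Y\in\mathrm{Mat}_n(\mathbf{F}_q),\ YM=MY\}=\{\theta^k:\theta\in\mathbf{F}_q\}$.
   Context: Let $K$ be a field and $M\in\mathrm{Mat}_n(K)$. Let $f_1,\dots,f_t$ be the distinct monic irreducible factors over $K$ of the characteristic polynomial of $M$. For each $i$, let $\lambda_i=(\lambda_i(1),\lambda_i(2),\dots)$ be the partition (weakly decreasing finite sequence of positive integers, its parts) such that the $f_i$-primary component of the $K[x]$-module $K^n$ (with $x$ acting as $M$) is isomorphic to $\bigoplus_j K[x]/(f_i^{\lambda_i(j)})$. The part-size invariant of $M$ is the highest common factor of all of the parts of the partitions $\lambda_1,\dots,\lambda_t$. *)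

theory Defs
  imports
    "Jordan_Normal_Form.Char_Poly"
    "Jordan_Normal_Form.VS_Connect"
    "HOL-Algebra.QuotRing"
begin

definition module_isomorphic ::
    "('r, 'c) ring_scheme \<Rightarrow> ('r, 'a, 'd) module_scheme \<Rightarrow> ('r, 'b, 'e) module_scheme \<Rightarrow> bool"
  where "module_isomorphic R A B \<longleftrightarrow>
    (\<exists>h \<in> LinearCombinations.module_hom R A B. bij_betw h (carrier A) (carrier B))"

text \<open>The record fields \<open>mult\<close> and \<open>one\<close> of modules play no role in the module
  structure; where there is no natural choice they are left undefined.\<close>

text \<open>Direct sum of a family of modules over a finite index set \<open>I\<close> (for infinite \<open>I\<close> this
  would be the direct product).\<close>

definition finite_direct_sum ::
    "'i set \<Rightarrow> ('i \<Rightarrow> ('r, 'a) module) \<Rightarrow> ('r, 'i \<Rightarrow> 'a) module"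
  where "finite_direct_sum I N = \<lparr>
    carrier = (\<Pi>\<^sub>E i\<in>I. carrier (N i)),
    mult = undefined,
    one = undefined,
    zero = (\<lambda>i\<in>I. \<zero>\<^bsub>N i\<^esub>),
    add = (\<lambda>u v. \<lambda>i\<in>I. u i \<oplus>\<^bsub>N i\<^esub> v i),
    smult = (\<lambda>r u. \<lambda>i\<in>I. r \<odot>\<^bsub>N i\<^esub> u i)\<rparr>"

abbreviation poly_ring :: "'a::field poly ring"
  where "poly_ring \<equiv> class_ring"

text \<open>\<open>K[x]/(g)\<close> as a \<open>K[x]\<close>-module; its elements are the cosets of the ideal \<open>(g)\<close>.\<close>

definition cyclic_module :: "'a::field poly \<Rightarrow> ('a poly, 'a poly set) module"
  where "cyclic_module g = (let I = PIdl\<^bsub>poly_ring\<^esub> g; Q = poly_ring Quot I in \<lparr>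
    carrier = carrier Q,
    mult = mult Q,
    one = \<one>\<^bsub>Q\<^esub>,
    zero = \<zero>\<^bsub>Q\<^esub>,
    add = add Q,
    smult = (\<lambda>p X. (I +>\<^bsub>poly_ring\<^esub> p) \<otimes>\<^bsub>Q\<^esub> X)\<rparr>)"

text \<open>\<open>K\<^sup>n\<close> (column vectors) as a \<open>K[x]\<close>-module on which \<open>x\<close> acts as the square matrix \<open>M\<close>.\<close>

definition matrix_module :: "'a::field mat \<Rightarrow> ('a poly, 'a vec) module"
  where "matrix_module M = \<lparr>
    carrier = carrier_vec (dim_row M),
    mult = undefined,
    one = undefined,
    zero = 0\<^sub>v (dim_row M),
    add = (+),
    smult = (\<lambda>p v. finsum_vec TYPE('a) (dim_row M)
      (\<lambda>i. coeff p i \<cdot>\<^sub>v ((M ^\<^sub>m i) *\<^sub>v v)) {..degree p})\<rparr>"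

definition primary_component :: "'a::field mat \<Rightarrow> 'a poly \<Rightarrow> ('a poly, 'a vec) module"
  where "primary_component M f = (matrix_module M)
    \<lparr>carrier := {v \<in> carrier (matrix_module M).
       \<exists>m::nat. (f ^ m) \<odot>\<^bsub>matrix_module M\<^esub> v = \<zero>\<^bsub>matrix_module M\<^esub>}\<rparr>"

definition is_partition :: "nat list \<Rightarrow> bool"
  where "is_partition l \<longleftrightarrow> sorted_wrt (\<ge>) l \<and> (\<forall>a \<in> set l. 0 < a)"

definition is_primary_partition :: "'a::field mat \<Rightarrow> 'a poly \<Rightarrow> nat list \<Rightarrow> bool"
  where "is_primary_partition M f l \<longleftrightarrow> is_partition l \<and>
    module_isomorphic poly_ring (primary_component M f)
      (finite_direct_sum {..<length l} (\<lambda>j. cyclic_module (f ^ (l ! j))))"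

definition irreducible_factors :: "'a::field mat \<Rightarrow> 'a poly set"
  where "irreducible_factors M = {f. monic f \<and> irreducible f \<and> f dvd char_poly M}"

text \<open>A relation rather than a function, so that the existence and uniqueness of the partitions
  (the structure theorem for modules over \<open>K[x]\<close>) are not needed to define it.
  For the \<open>0 \<times> 0\<close> matrix there are no parts, and the invariant is \<open>0\<close>.\<close>

definition has_part_size_invariant :: "'a::field mat \<Rightarrow> nat \<Rightarrow> bool"
  where "has_part_size_invariant M k \<longleftrightarrow>
    (\<exists>part :: 'a poly \<Rightarrow> nat list.
      (\<forall>f \<in> irreducible_factors M. is_primary_partition M f (part f)) \<and>
      k = Gcd (\<Union>f \<in> irreducible_factors M. set (part f)))"

end

(* Let h be the product of the distinct irreducible factors of the characteristic polynomial. A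
   matrix Y commuting with M preserves the filtration h^s K^n, so det Y is the product over s of
   its determinants on the quotients h^s K^n / h^(s+1) K^n. Multiplication by h identifies the
   quotients s and s+1, compatibly with Y, unless s+1 is a part. If k divides all parts, the
   quotients therefore come in runs of length k with equal determinants, and det Y is a k-th power.

   Conversely, multiplying the summand K[x]/(f^a) by a polynomial g commutes with M and has
   determinant N(g)^a, where N is the norm from K[x]/(f) to K. Over a finite field N is onto, so
   every product of a-th powers with a running over the parts occurs, and by Bezout so does every
   k-th power. *)

theory Submission
  imports Defs "HOL-Algebra.Algebraic_Closure_Type"
begin

hide_const (open) Polynomials.degree Polynomials.lead_coeff UnivPoly.coeff Coset.order Module.smult UnivPoly.monom Divisibility.irreducible Divisibility.prime
no_notation fps_nth (infixl \<open>$\<close> 75)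

section \<open>Determinants in indexed bases\<close>

text \<open>All determinants are computed in explicit coordinates. The module isomorphisms supply
  generators e_i of cyclic summands K[x]/(f_i^(a_i)), and the vectors h^s x^t e_i with s < a_i and t
  < deg f_i form a basis of K^n adapted to the filtration. A power of f_i alone acts invertibly on
  the other primary components, so no single f_i filters the whole space down to zero. The product h
  does, and since h = f_i u with u invertible modulo f_i^(a_i), it can still serve as the base of
  digit expansions in every summand. Multiplication by h then shifts digits, which is how the
  identification of consecutive quotients becomes visible in the matrix of Y.

  Two degenerate cases stand apart. Bezout coefficients may be negative, so the value 0 needs its
  own matrix. The invariant 0 means that there are no parts at all, as parts are positive.\<close>

definition list_det :: "'i list \<Rightarrow> ('i \<Rightarrow> 'i \<Rightarrow> 'a::comm_ring_1) \<Rightarrow> 'a"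
  where "list_det xs A = det (mat (length xs) (length xs) (\<lambda>(i, j). A (xs ! i) (xs ! j)))"

lemma list_det_Nil [simp]: "list_det [] A = 1"
  by (simp add: list_det_def det_dim_zero)

lemma list_det_cong:
  assumes "xs = ys" and "\<And>x y. x \<in> set ys \<Longrightarrow> y \<in> set ys \<Longrightarrow> A x y = B x y"
  shows "list_det xs A = list_det ys B"
  unfolding list_det_def assms(1)
  by (intro arg_cong[of _ _ det] eq_matI) (auto simp: assms(2))

text \<open>Relabelling keeps the matrix of entries. Blocks that belong to different steps of the
  filtration can thus be written over the same labels and compared.\<close>

lemma list_det_map: "list_det (map g xs) A = list_det xs (\<lambda>x y. A (g x) (g y))"
  unfolding list_det_def by (intro arg_cong[of _ _ det] eq_matI) auto

lemma list_det_append: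
  assumes "\<And>x y. x \<in> set xs \<Longrightarrow> y \<in> set ys \<Longrightarrow> A x y = 0"
  shows "list_det (xs @ ys) A = list_det xs A * list_det ys (A :: 'i \<Rightarrow> 'i \<Rightarrow> 'a::idom)"
proof -
  let ?m = "length xs" and ?n = "length ys"
  let ?blk = "\<lambda>us vs. mat (length us) (length vs) (\<lambda>(i, j). A (us ! i) (vs ! j))"
  have "mat (length (xs @ ys)) (length (xs @ ys)) (\<lambda>(i, j). A ((xs @ ys) ! i) ((xs @ ys) ! j))
      = four_block_mat (?blk xs xs) (0\<^sub>m ?m ?n) (?blk ys xs) (?blk ys ys)"
    by (rule eq_matI) (auto simp: nth_append assms)
  then show ?thesis
    unfolding list_det_def
    by (simp add: det_four_block_mat_upper_right_zero[of _ ?m _ ?n])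
qed

lemma list_det_concat_triangular:
  assumes "\<And>s t x y. s < t \<Longrightarrow> t < N \<Longrightarrow> x \<in> set (L s) \<Longrightarrow> y \<in> set (L t) \<Longrightarrow> A x y = 0"
  shows "list_det (concat (map L [0..<N])) A
    = (\<Prod>s<N. list_det (L s) (A :: 'i \<Rightarrow> 'i \<Rightarrow> 'a::idom))"
  using assms
proof (induction N)
  case (Suc N)
  have "list_det (concat (map L [0..<N]) @ L N) A = list_det (concat (map L [0..<N])) A * list_det (L N) A"
    by (rule list_det_append) (auto intro: Suc.prems)
  then show ?case using Suc by simp
qed simp

lemma list_det_concat_diagonal:
  assumes "distinct is"
    and "\<And>i j x y. i \<in> set is \<Longrightarrow> j \<in> set is \<Longrightarrow> i \<noteq> j \<Longrightarrow>
      x \<in> set (L i) \<Longrightarrow> y \<in> set (L j) \<Longrightarrow> A x y = 0"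
  shows "list_det (concat (map L is)) A
    = (\<Prod>i\<in>set is. list_det (L i) (A :: 'i \<Rightarrow> 'i \<Rightarrow> 'a::idom))"
  using assms
proof (induction "is")
  case (Cons i js)
  have "list_det (L i @ concat (map L js)) A = list_det (L i) A * list_det (concat (map L js)) A"
    by (rule list_det_append) (use Cons.prems in auto)
  moreover have "list_det (concat (map L js)) A = (\<Prod>j\<in>set js. list_det (L j) A)"
    by (rule Cons.IH) (use Cons.prems in auto)
  ultimately show ?case using Cons.prems by simp
qed simp

text \<open>Defined through coordinates, so that dimension and entries of a sum come without carrier
  premises on the summands.\<close>

definition vsum :: "nat \<Rightarrow> ('i \<Rightarrow> 'a::comm_ring_1 vec) \<Rightarrow> 'i set \<Rightarrow> 'a vec"
  where "vsum n f A = vec n (\<lambda>l. \<Sum>x\<in>A. f x $ l)"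

lemma vsum_carrier [simp]: "vsum n f A \<in> carrier_vec n"
  and vsum_dim [simp]: "dim_vec (vsum n f A) = n"
  and vsum_index [simp]: "l < n \<Longrightarrow> vsum n f A $ l = (\<Sum>x\<in>A. f x $ l)"
  by (auto simp: vsum_def)

lemma vsum_cong: "A = B \<Longrightarrow> (\<And>x. x \<in> B \<Longrightarrow> f x = g x) \<Longrightarrow> vsum n f A = vsum n g B"
  by (simp add: vsum_def)

lemma vsum_empty [simp]: "vsum n f {} = 0\<^sub>v n"
  by (auto simp: vsum_def)

lemma vsum_insert:
  assumes "finite A" "x \<notin> A" "f x \<in> carrier_vec n"
  shows "vsum n f (insert x A) = f x + vsum n f A"
  by (rule eq_vecI) (use assms in auto)

lemma vsum_zero [simp]: "vsum n (\<lambda>x. 0\<^sub>v n) A = 0\<^sub>v n"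
  by (rule eq_vecI) auto

lemma vsum_neutral: "(\<And>x. x \<in> A \<Longrightarrow> f x = 0\<^sub>v n) \<Longrightarrow> vsum n f A = 0\<^sub>v n"
  using vsum_cong[of A A f "\<lambda>x. 0\<^sub>v n" n] by simp

lemma vsum_add:
  assumes "\<And>x. x \<in> A \<Longrightarrow> f x \<in> carrier_vec n" "\<And>x. x \<in> A \<Longrightarrow> g x \<in> carrier_vec n"
  shows "vsum n (\<lambda>x. f x + g x) A = vsum n f A + vsum n g A"
proof (rule eq_vecI)
  fix l assume "l < dim_vec (vsum n f A + vsum n g A)"
  then have l: "l < n" by simp
  have "(\<Sum>x\<in>A. (f x + g x) $ l) = (\<Sum>x\<in>A. f x $ l + g x $ l)"
    using l carrier_vecD[OF assms(2)] by (intro sum.cong) auto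
  then show "vsum n (\<lambda>x. f x + g x) A $ l = (vsum n f A + vsum n g A) $ l"
    using l by (simp add: sum.distrib)
qed simp

lemma vsum_single:
  assumes "finite A" "a \<in> A" "f a \<in> carrier_vec n" "\<And>x. x \<in> A \<Longrightarrow> x \<noteq> a \<Longrightarrow> f x = 0\<^sub>v n"
  shows "vsum n f A = f a"
proof (rule eq_vecI)
  fix l assume "l < dim_vec (f a)"
  then have l: "l < n" using assms by auto
  then have "(\<Sum>x\<in>A. f x $ l) = (\<Sum>x\<in>A. if x = a then f a $ l else 0)"
    by (intro sum.cong) (auto simp: assms(4))
  then show "vsum n f A $ l = f a $ l" using l assms by simp
qed (use assms in auto)

text \<open>Only additivity is asked of \<open>T\<close>, so this covers the action of a polynomial
  as well as a map that is not yet known to be given by a matrix.\<close>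

lemma vsum_additive:
  assumes "finite A" and "\<And>x. x \<in> A \<Longrightarrow> f x \<in> carrier_vec n"
    and "\<And>u v. u \<in> carrier_vec n \<Longrightarrow> v \<in> carrier_vec n \<Longrightarrow> T (u + v) = T u + T v"
    and "T (0\<^sub>v n) = 0\<^sub>v m" and "\<And>u. u \<in> carrier_vec n \<Longrightarrow> T u \<in> carrier_vec m"
  shows "T (vsum n f A) = vsum m (\<lambda>x. T (f x)) A"
  using assms(1,2)
proof (induction rule: finite_induct)
  case (insert x A)
  then show ?case by (simp add: vsum_insert assms(3-5))
qed (simp add: assms)

lemma vsum_Sigma:
  assumes "finite A" "\<And>x. x \<in> A \<Longrightarrow> finite (B x)"
  shows "vsum n (\<lambda>(x, y). f x y) (SIGMA x:A. B x) = vsum n (\<lambda>x. vsum n (f x) (B x)) A"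
  by (rule eq_vecI) (auto simp: sum.Sigma assms split_def)

text \<open>If m < n, padding both factors with zeros to size n leaves the product unchanged, but
  the padded \<open>P\<close> has a zero column and cannot be invertible.\<close>

lemma left_inverse_dims:
  fixes P :: "'a::field mat"
  assumes P: "P \<in> carrier_mat n m" and Q: "Q \<in> carrier_mat m n" and PQ: "P * Q = 1\<^sub>m n"
  shows "n \<le> m"
proof (rule ccontr)
  assume "\<not> n \<le> m"
  then have mn: "m < n" by simp
  define P' where "P' = mat n n (\<lambda>(i, j). if j < m then P $$ (i, j) else 0)"
  define Q' where "Q' = mat n n (\<lambda>(i, j). if i < m then Q $$ (i, j) else 0)"
  have c: "P' \<in> carrier_mat n n" "Q' \<in> carrier_mat n n" by (auto simp: P'_def Q'_def)
  have "P' * Q' = P * Q"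
  proof (rule eq_matI)
    fix i j assume "i < dim_row (P * Q)" "j < dim_col (P * Q)"
    then have ij: "i < n" "j < n" using P Q by auto
    have "(P' * Q') $$ (i, j) = (\<Sum>k\<in>{0..<n}. if k < m then P $$ (i, k) * Q $$ (k, j) else 0)"
      using ij by (auto simp: P'_def Q'_def scalar_prod_def intro!: sum.cong)
    also have "\<dots> = (\<Sum>k\<in>{0..<m}. P $$ (i, k) * Q $$ (k, j))"
      using mn by (intro sum.mono_neutral_cong_right) auto
    also have "\<dots> = (P * Q) $$ (i, j)" using ij P Q by (auto simp: scalar_prod_def)
    finally show "(P' * Q') $$ (i, j) = (P * Q) $$ (i, j)" .
  qed (use P Q c in auto)
  then have "det P' * det Q' = 1" using det_mult[OF c] PQ by simp
  moreover have "P' *\<^sub>v unit_vec n m = 0\<^sub>v n"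
    using mn by (intro eq_vecI) (auto simp: P'_def)
  then have "det P' = 0"
    using det_0_iff_vec_prod_zero_field[OF c(1)] mn unit_vec_nonzero[OF mn]
    by (metis unit_vec_carrier)
  ultimately show False by simp
qed

section \<open>Bases and the matrix of an endomorphism\<close>

definition is_basis :: "nat \<Rightarrow> ('i \<Rightarrow> 'a::field vec) \<Rightarrow> 'i list \<Rightarrow> bool"
  where "is_basis n b xs \<longleftrightarrow> distinct xs \<and> (\<forall>x\<in>set xs. b x \<in> carrier_vec n) \<and>
    (\<forall>v\<in>carrier_vec n. \<exists>c. v = vsum n (\<lambda>x. c x \<cdot>\<^sub>v b x) (set xs)) \<and>
    (\<forall>c. vsum n (\<lambda>x. c x \<cdot>\<^sub>v b x) (set xs) = 0\<^sub>v n \<longrightarrow> (\<forall>x\<in>set xs. c x = 0))"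

text \<open>Spanning gives a \<open>Q\<close> with P Q = 1. Then P (Q P - 1) = 0, so the columns of
  Q P - 1 are linear relations among the basis vectors and vanish by independence. The two one-sided
  inverses bound the length of the list from both sides.\<close>

lemma is_basis_invertible:
  fixes b :: "'i \<Rightarrow> 'a::field vec"
  assumes B: "is_basis n b xs"
  defines "P \<equiv> mat n (length xs) (\<lambda>(l, j). b (xs ! j) $ l)"
  shows "length xs = n" and "det P \<noteq> 0"
proof -
  let ?m = "length xs"
  have sumx: "(\<Sum>x\<in>set xs. g x) = (\<Sum>i\<in>{0..<?m}. g (xs ! i))" for g :: "'i \<Rightarrow> 'a"
    using B by (simp add: is_basis_def sum_list_distinct_conv_sum_set[symmetric] sum_list_sum_nth)
  have P: "P \<in> carrier_mat n ?m" by (simp add: P_def)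
  have "\<exists>c. unit_vec n j = vsum n (\<lambda>x. c x \<cdot>\<^sub>v b x) (set xs)" for j
    using B unfolding is_basis_def by auto
  then obtain c where c: "\<And>j. unit_vec n j = vsum n (\<lambda>x. c j x \<cdot>\<^sub>v b x) (set xs)" by metis
  define Q where "Q = mat ?m n (\<lambda>(i, j). c j (xs ! i))"
  have Q: "Q \<in> carrier_mat ?m n" by (simp add: Q_def)
  have bc: "b x \<in> carrier_vec n" if "x \<in> set xs" for x using B that by (auto simp: is_basis_def)
  have PQ: "P * Q = 1\<^sub>m n"
  proof (rule eq_matI)
    fix l j assume "l < dim_row (1\<^sub>m n :: 'a mat)" "j < dim_col (1\<^sub>m n :: 'a mat)"
    then have lj: "l < n" "j < n" by auto
    have "(1\<^sub>m n :: 'a mat) $$ (l, j) = unit_vec n j $ l" using lj by (auto simp: unit_vec_def)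
    also have "\<dots> = (\<Sum>x\<in>set xs. c j x * b x $ l)"
      using lj by (subst c) (auto simp: carrier_vecD[OF bc] intro!: sum.cong)
    also have "\<dots> = (P * Q) $$ (l, j)"
      using lj by (auto simp: sumx P_def Q_def scalar_prod_def mult.commute intro!: sum.cong)
    finally show "(P * Q) $$ (l, j) = (1\<^sub>m n :: 'a mat) $$ (l, j)" ..
  qed (auto simp: P_def Q_def)
  have PQP: "P * (Q * P) = P" using P Q PQ by (simp flip: assoc_mult_mat)
  have QP: "Q * P = 1\<^sub>m ?m"
  proof (rule eq_matI)
    fix i j assume "i < dim_row (1\<^sub>m ?m :: 'a mat)" "j < dim_col (1\<^sub>m ?m :: 'a mat)"
    then have ij: "i < ?m" "j < ?m" by auto
    have dist: "distinct xs" using B by (simp add: is_basis_def)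
    define idx where "idx x = (THE i. i < ?m \<and> xs ! i = x)" for x
    have idx: "idx (xs ! i) = i" if "i < ?m" for i
      unfolding idx_def using that dist by (auto simp: nth_eq_iff_index_eq)
    \<comment> \<open>Column j of Q P - 1, carried from positions in the list to the labels
      themselves, because independence is stated for coefficients indexed by labels.\<close>
    define d where "d x = (Q * P) $$ (idx x, j) - (if idx x = j then 1 else 0)" for x
    have "vsum n (\<lambda>x. d x \<cdot>\<^sub>v b x) (set xs) = 0\<^sub>v n"
    proof (rule eq_vecI)
      fix l assume "l < dim_vec (0\<^sub>v n :: 'a vec)"
      then have l: "l < n" by simp
      have "vsum n (\<lambda>x. d x \<cdot>\<^sub>v b x) (set xs) $ l = (\<Sum>x\<in>set xs. d x * b x $ l)"
        using l by (auto simp: carrier_vecD[OF bc] intro!: sum.cong)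
      also have "\<dots> = (\<Sum>i\<in>{0..<?m}. P $$ (l, i) * (Q * P) $$ (i, j))
          - (\<Sum>i\<in>{0..<?m}. if i = j then P $$ (l, j) else 0)"
        unfolding sumx sum_subtractf[symmetric]
        using l ij by (intro sum.cong) (auto simp: d_def idx P_def algebra_simps)
      also have "\<dots> = (P * (Q * P)) $$ (l, j) - P $$ (l, j)"
        using l ij P Q by (auto simp: scalar_prod_def)
      also have "\<dots> = 0" by (simp add: PQP)
      finally show "vsum n (\<lambda>x. d x \<cdot>\<^sub>v b x) (set xs) $ l = 0\<^sub>v n $ l" using l by simp
    qed auto
    then have "d (xs ! i) = 0" using B ij by (auto simp: is_basis_def)
    then show "(Q * P) $$ (i, j) = (1\<^sub>m ?m :: 'a mat) $$ (i, j)" using ij by (auto simp: d_def idx)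
  qed (auto simp: P_def Q_def)
  show m: "length xs = n"
    using left_inverse_dims[OF P Q PQ] left_inverse_dims[OF Q P QP] by simp
  have "det P * det Q = 1" using det_mult[of P n Q] P Q PQ m by simp
  then show "det P \<noteq> 0" by auto
qed

text \<open>With the basis vectors as columns of \<open>P\<close>, the assumption reads Y P = P C,
  where \<open>C\<close> is the matrix of \<open>A\<close>; the nonzero det P cancels.\<close>

lemma det_in_basis:
  fixes b :: "'i \<Rightarrow> 'a::field vec"
  assumes B: "is_basis n b xs" and Y: "Y \<in> carrier_mat n n"
    and A: "\<And>x. x \<in> set xs \<Longrightarrow> Y *\<^sub>v b x = vsum n (\<lambda>z. A z x \<cdot>\<^sub>v b z) (set xs)"
  shows "det Y = list_det xs A"
proof -
  define P where "P = mat n (length xs) (\<lambda>(l, j). b (xs ! j) $ l)"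
  have len: "length xs = n" and dP: "det P \<noteq> 0"
    using is_basis_invertible[OF B] by (auto simp: P_def)
  have P: "P \<in> carrier_mat n n" by (simp add: P_def len)
  have sumx: "(\<Sum>x\<in>set xs. g x) = (\<Sum>i\<in>{0..<n}. g (xs ! i))" for g :: "'i \<Rightarrow> 'a"
    using B len by (simp add: is_basis_def sum_list_distinct_conv_sum_set[symmetric] sum_list_sum_nth)
  define C where "C = mat n n (\<lambda>(i, j). A (xs ! i) (xs ! j))"
  have C: "C \<in> carrier_mat n n" by (simp add: C_def)
  have bc: "b x \<in> carrier_vec n" if "x \<in> set xs" for x using B that by (auto simp: is_basis_def)
  have "Y * P = P * C"
  proof (rule eq_matI)
    fix l j assume "l < dim_row (P * C)" "j < dim_col (P * C)"
    then have lj: "l < n" "j < n" using P C by auto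
    have x: "xs ! j \<in> set xs" using lj len by simp
    have colP: "col P j = b (xs ! j)" using lj bc[OF x] by (auto simp: P_def len)
    have "(Y * P) $$ (l, j) = (Y *\<^sub>v b (xs ! j)) $ l" using lj Y P colP by auto
    also have "\<dots> = (\<Sum>z\<in>set xs. A z (xs ! j) * b z $ l)"
      unfolding A[OF x] using lj by (auto simp: carrier_vecD[OF bc] intro!: sum.cong)
    also have "\<dots> = (P * C) $$ (l, j)"
      using lj by (auto simp: sumx P_def C_def len scalar_prod_def mult.commute intro!: sum.cong)
    finally show "(Y * P) $$ (l, j) = (P * C) $$ (l, j)" .
  qed (use Y P C in auto)
  then have "det Y * det P = det P * det C" by (metis det_mult[OF Y P] det_mult[OF P C])
  then have "det Y = det C" using dP by auto
  then show ?thesis by (simp add: list_det_def C_def len)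
qed

section \<open>The action of polynomials on vectors\<close>

abbreviation act :: "'a::field mat \<Rightarrow> 'a poly \<Rightarrow> 'a vec \<Rightarrow> 'a vec"
  where "act M p v \<equiv> p \<odot>\<^bsub>matrix_module M\<^esub> v"

text \<open>The free bound \<open>N\<close> allows polynomials of different degrees to be compared
  over one range of summation.\<close>

lemma act_index:
  assumes "M \<in> carrier_mat n n" "v \<in> carrier_vec n" "degree p \<le> N" "l < n"
  shows "act M p v $ l = (\<Sum>i\<le>N. coeff p i * (M ^\<^sub>m i *\<^sub>v v) $ l)"
proof -
  have Mv: "M ^\<^sub>m i *\<^sub>v v \<in> carrier_vec n" for i
    using assms by (meson mult_mat_vec_carrier pow_carrier_mat)
  have "act M p v $ l = (\<Sum>i\<le>degree p. coeff p i * (M ^\<^sub>m i *\<^sub>v v) $ l)"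
    using assms Mv by (auto simp: matrix_module_def index_finsum_vec intro!: sum.cong)
  also have "\<dots> = (\<Sum>i\<le>N. coeff p i * (M ^\<^sub>m i *\<^sub>v v) $ l)"
    using assms by (intro sum.mono_neutral_left) (auto simp: coeff_eq_0)
  finally show ?thesis .
qed

lemma act_closed [simp]:
  assumes "M \<in> carrier_mat n n" "v \<in> carrier_vec n"
  shows "act M p v \<in> carrier_vec n"
proof -
  have Mv: "M ^\<^sub>m i *\<^sub>v v \<in> carrier_vec n" for i
    using assms by (meson mult_mat_vec_carrier pow_carrier_mat)
  then show ?thesis using assms by (auto simp: matrix_module_def intro!: finsum_vec_closed)
qed

context
  fixes M :: "'a::field mat" and n :: nat
  assumes M: "M \<in> carrier_mat n n"
begin

lemma act_dim [simp]: "v \<in> carrier_vec n \<Longrightarrow> dim_vec (act M p v) = n"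
  by (rule carrier_vecD[OF act_closed[OF M]])

lemma act_zero_left [simp]: "v \<in> carrier_vec n \<Longrightarrow> act M 0 v = 0\<^sub>v n"
  by (rule eq_vecI) (auto simp: act_index[OF M, of _ _ 0])

text \<open>Horner's rule. It replaces the sum over powers of M by a recursion, on which the
  inductions over polynomials below rest.\<close>

lemma act_pCons:
  assumes v: "v \<in> carrier_vec n"
  shows "act M (pCons a p) v = a \<cdot>\<^sub>v v + M *\<^sub>v act M p v"
proof (rule eq_vecI)
  fix l assume "l < dim_vec (a \<cdot>\<^sub>v v + M *\<^sub>v act M p v)"
  then have l: "l < n" using M by auto
  have Mi: "M ^\<^sub>m i \<in> carrier_mat n n" for i using M by (rule pow_carrier_mat)
  \<comment> \<open>Matrix powers grow by a factor on the right, whereas Horner's rule needs the new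
    factor on the left.\<close>
  have pow: "M ^\<^sub>m Suc i *\<^sub>v v = M *\<^sub>v (M ^\<^sub>m i *\<^sub>v v)" for i
  proof -
    have "M ^\<^sub>m Suc i = M * M ^\<^sub>m i" using M
    proof (induction i)
      case (Suc i)
      have "M ^\<^sub>m Suc (Suc i) = M ^\<^sub>m Suc i * M" by simp
      also have "\<dots> = M * M ^\<^sub>m i * M" by (simp only: Suc.IH[OF M])
      also have "\<dots> = M * (M ^\<^sub>m i * M)" using M Mi by (intro assoc_mult_mat)
      finally show ?case by simp
    qed simp
    then show ?thesis using M Mi v by (metis assoc_mult_mat_vec)
  qed
  have Mv: "M ^\<^sub>m i *\<^sub>v v \<in> carrier_vec n" for i using Mi v by (rule mult_mat_vec_carrier)
  let ?N = "degree p"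
  have "act M (pCons a p) v $ l = (\<Sum>i\<le>Suc ?N. coeff (pCons a p) i * (M ^\<^sub>m i *\<^sub>v v) $ l)"
    by (rule act_index[OF M v _ l]) (simp add: degree_pCons_le)
  also have "\<dots> = a * v $ l + (\<Sum>i\<le>?N. coeff p i * (M *\<^sub>v (M ^\<^sub>m i *\<^sub>v v)) $ l)"
    using v M by (simp only: sum.atMost_Suc_shift pow coeff_pCons_Suc coeff_pCons_0) simp
  also have "(\<Sum>i\<le>?N. coeff p i * (M *\<^sub>v (M ^\<^sub>m i *\<^sub>v v)) $ l)
      = (\<Sum>i\<le>?N. \<Sum>m\<in>{0..<n}. M $$ (l, m) * (coeff p i * (M ^\<^sub>m i *\<^sub>v v) $ m))"
    using l M Mv by (intro sum.cong) (auto simp: scalar_prod_def sum_distrib_left carrier_vecD[OF Mv] algebra_simps intro!: sum.cong)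
  also have "\<dots> = (\<Sum>m\<in>{0..<n}. M $$ (l, m) * act M p v $ m)"
    unfolding sum.swap[of _ "{0..<n}"]
    by (intro sum.cong) (auto simp: act_index[OF M v order.refl] sum_distrib_left)
  also have "\<dots> = (M *\<^sub>v act M p v) $ l"
    using l M v act_closed[OF M v, of p] by (auto simp: scalar_prod_def intro!: sum.cong)
  finally show "act M (pCons a p) v $ l = (a \<cdot>\<^sub>v v + M *\<^sub>v act M p v) $ l" using l v M by simp
qed (use M v in auto)

lemma act_zero_right [simp]: "act M p (0\<^sub>v n) = 0\<^sub>v n"
proof (induction p)
  case (pCons a p)
  then show ?case by (simp add: act_pCons) (rule eq_vecI, use M in auto)
qed simp

lemma act_add_left:
  assumes v: "v \<in> carrier_vec n"
  shows "act M (p + q) v = act M p v + act M q v"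
proof (rule eq_vecI)
  fix l assume "l < dim_vec (act M p v + act M q v)"
  then have l: "l < n" using v by simp
  let ?N = "max (degree p) (degree q)"
  show "act M (p + q) v $ l = (act M p v + act M q v) $ l"
    using l v
    by (simp add: act_index[OF M v, of _ ?N] degree_add_le sum.distrib distrib_right)
qed (use v in auto)

lemma act_smult:
  assumes v: "v \<in> carrier_vec n"
  shows "act M (smult a q) v = a \<cdot>\<^sub>v act M q v"
proof (rule eq_vecI)
  fix l assume "l < dim_vec (a \<cdot>\<^sub>v act M q v)"
  then have l: "l < n" using v by simp
  then show "act M (smult a q) v $ l = (a \<cdot>\<^sub>v act M q v) $ l"
    using v
    by (simp add: act_index[OF M v, of _ "degree q"] sum_distrib_left algebra_simps)
qed (use v in auto)

lemma act_mult:
  assumes v: "v \<in> carrier_vec n"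
  shows "act M (p * q) v = act M p (act M q v)"
proof (induction p)
  case (pCons a p)
  have "act M (pCons a p * q) v = act M (smult a q) v + act M (pCons 0 (p * q)) v"
    using v by (simp add: act_add_left)
  also have "\<dots> = a \<cdot>\<^sub>v act M q v + M *\<^sub>v act M (p * q) v"
    using v M act_closed[OF M v, of "p * q"] by (subst act_pCons[OF v]) (auto simp: act_smult)
  finally show ?case using v M by (simp add: act_pCons pCons.IH)
next
  case 0
  show ?case using v M by (simp add: act_zero_left[of "act M q v"])
qed

lemma act_one [simp]: "v \<in> carrier_vec n \<Longrightarrow> act M 1 v = v"
  unfolding one_pCons by (subst act_pCons) (use M in auto)

lemma act_add_right:
  assumes u: "u \<in> carrier_vec n" and v: "v \<in> carrier_vec n"
  shows "act M p (u + v) = act M p u + act M p v"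
proof (induction p)
  case (pCons a p)
  have "act M p u \<in> carrier_vec n" "act M p v \<in> carrier_vec n" using M u v by auto
  then show ?case using u v M
    by (simp add: act_pCons pCons.IH mult_add_distrib_mat_vec[OF M] smult_add_distrib_vec[OF u v])
       (rule eq_vecI, auto)
qed (use u v in auto)

lemma act_commute:
  assumes Y: "Y \<in> carrier_mat n n" "Y * M = M * Y" and v: "v \<in> carrier_vec n"
  shows "Y *\<^sub>v act M p v = act M p (Y *\<^sub>v v)"
proof (induction p)
  case (pCons a p)
  have Yv: "Y *\<^sub>v v \<in> carrier_vec n" and pv: "act M p v \<in> carrier_vec n" using Y v M by auto
  have "Y *\<^sub>v act M (pCons a p) v = Y *\<^sub>v (a \<cdot>\<^sub>v v) + Y *\<^sub>v (M *\<^sub>v act M p v)"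
    using Y v M pv by (subst act_pCons[OF v]) (auto intro!: mult_add_distrib_mat_vec)
  also have "Y *\<^sub>v (M *\<^sub>v act M p v) = (M * Y) *\<^sub>v act M p v"
    using assoc_mult_mat_vec[OF Y(1) M pv] Y by simp
  also have "\<dots> = M *\<^sub>v (Y *\<^sub>v act M p v)"
    using assoc_mult_mat_vec[OF M Y(1) pv] by simp
  also have "Y *\<^sub>v (a \<cdot>\<^sub>v v) = a \<cdot>\<^sub>v (Y *\<^sub>v v)" using Y(1) v by (rule mult_mat_vec)
  finally show ?case by (simp add: act_pCons[OF Yv] pCons.IH)
next
  case 0
  have Yv: "Y *\<^sub>v v \<in> carrier_vec n" using Y v by auto
  show ?case using Y v by (simp add: act_zero_left[OF Yv]) (rule eq_vecI, auto)
qed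

lemma act_vsum:
  assumes "finite A" "\<And>x. x \<in> A \<Longrightarrow> f x \<in> carrier_vec n"
  shows "act M p (vsum n f A) = vsum n (\<lambda>x. act M p (f x)) A"
  by (rule vsum_additive) (use assms M in \<open>auto simp: act_add_right\<close>)

lemma act_sum:
  assumes "finite A" "v \<in> carrier_vec n"
  shows "act M (\<Sum>x\<in>A. p x) v = vsum n (\<lambda>x. act M (p x) v) A"
  using assms(1) by (induction rule: finite_induct) (auto simp: assms act_add_left vsum_insert M)

end

section \<open>The norm from a finite extension of a finite field\<close>

lemma degree_irreducible_pos: "irreducible (f :: 'a::field poly) \<Longrightarrow> degree f > 0"
  by (metis gr0I irreducible_not_unit is_unit_iff_degree not_irreducible_zero)

text \<open>A nonzero combination of f and R of least degree divides all combinations, since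
  remainders are again combinations. It divides the irreducible f; were it not a unit, f would
  divide it and hence R.\<close>

lemma irreducible_bezout:
  fixes f R :: "'a::field poly"
  assumes f: "irreducible f" and R: "\<not> f dvd R"
  shows "\<exists>u w. u * f + w * R = 1"
proof -
  let ?S = "\<lambda>g. g \<noteq> 0 \<and> (\<exists>u w. g = u * f + w * R)"
  have "f = 1 * f + 0 * R" by simp
  then have "?S f" using f by (metis not_irreducible_zero)
  then obtain g where g: "?S g" and min: "\<And>h. ?S h \<Longrightarrow> degree g \<le> degree h"
    using ex_has_least_nat[of ?S f degree] by blast
  obtain u w where uw: "g = u * f + w * R" using g by auto
  have dvd: "g dvd h" if "h = a * f + b * R" for h a b
  proof (rule ccontr)
    assume "\<not> g dvd h"
    then have nz: "h mod g \<noteq> 0" by (simp add: dvd_eq_mod_eq_0)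
    have "h mod g = h - (h div g) * g" by (simp add: minus_div_mult_eq_mod)
    also have "\<dots> = (a - (h div g) * u) * f + (b - (h div g) * w) * R"
      unfolding that(1) uw[symmetric] by (subst (2) uw) (simp add: algebra_simps)
    finally have "degree g \<le> degree (h mod g)" using nz min by blast
    then show False using degree_mod_less'[of g h] g nz by auto
  qed
  have "g dvd f" by (rule dvd[of _ 1 0]) simp
  moreover have "g dvd R" by (rule dvd[of _ 0 1]) simp
  ultimately have "is_unit g"
    using f R by (meson dvd_trans irreducibleD')
  then obtain h where "1 = g * h" by (rule dvdE)
  then have "(h * u) * f + (h * w) * R = 1" using uw by (simp add: algebra_simps)
  then show ?thesis by blast
qed

text \<open>In the product of the relations for f^m and for f, every term except the one with
  f^(m+1) keeps a factor R.\<close>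

lemma irreducible_power_bezout:
  fixes f R :: "'a::field poly"
  assumes f: "irreducible f" and R: "\<not> f dvd R"
  shows "\<exists>u w. u * f ^ m + w * R = 1"
proof (induction m)
  case 0
  have "1 * f ^ 0 + 0 * R = 1" by simp
  then show ?case by blast
next
  case (Suc m)
  then obtain u w where 1: "u * f ^ m + w * R = 1" by blast
  obtain u' w' where 2: "u' * f + w' * R = 1" using irreducible_bezout[OF f R] by blast
  have "(u * f ^ m + w * R) * (u' * f + w' * R) = 1" by (simp only: 1 2) simp
  then have "(u * u') * f ^ Suc m + (u * f ^ m * w' + w * (u' * f + w' * R)) * R = 1"
    by (simp add: algebra_simps)
  then show ?case by blast
qed

lemma finite_field_card_gt_1: "card (UNIV :: 'a::finite_field set) > 1"
  using card_mono[of UNIV "{0, 1 :: 'a}"] by simp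

text \<open>Both sides agree at all \<open>q\<close> points of the field, and their difference has degree less than \<open>q\<close>.
  This gives additivity of \<open>x \<mapsto> x\<^sup>q\<close> on extensions without knowing that \<open>q\<close> is a prime power.\<close>

lemma finite_field_binomial_poly:
  "[:1, 1:] ^ card (UNIV :: 'a::finite_field set) = monom 1 (card (UNIV :: 'a set)) + (1 :: 'a poly)"
proof -
  let ?q = "card (UNIV :: 'a set)"
  have q: "?q > 1" by (rule finite_field_card_gt_1)
  have "[:1, 1:] ^ ?q - monom 1 ?q = (1 :: 'a poly)"
  proof (rule poly_eqI_degree[of UNIV])
    show "poly ([:1, 1:] ^ ?q - monom 1 ?q) x = poly 1 x" for x :: 'a
      by (simp add: poly_monom finite_field_power_card_eq_same)
    have deg: "degree ([:1, 1:] ^ ?q :: 'a poly) = ?q" by (simp add: degree_power_eq)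
    have "coeff ([:1, 1:] ^ ?q - monom 1 ?q :: 'a poly) i = 0" if "i > ?q - 1" for i
    proof (cases "i = ?q")
      case True
      have "lead_coeff ([:1, 1:] ^ ?q :: 'a poly) = 1" by (simp add: lead_coeff_power)
      then show ?thesis using True deg by simp
    next
      case False
      then show ?thesis using that deg by (simp add: coeff_eq_0)
    qed
    then show "card (UNIV :: 'a set) > degree ([:1, 1:] ^ ?q - monom 1 ?q :: 'a poly)"
      using degree_le[of "?q - 1" "[:1, 1:] ^ ?q - monom 1 ?q :: 'a poly"] q by simp
    show "card (UNIV :: 'a set) > degree (1 :: 'a poly)" using q by simp
  qed
  then show ?thesis by (simp add: algebra_simps)
qed

lemma card_power_roots:
  fixes c :: "'b::field"
  assumes "m > 0"
  shows "finite {x. x ^ m = c}" "card {x. x ^ m = c} \<le> m"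
proof -
  let ?r = "monom 1 m - [:c:]"
  have "coeff ?r m = 1" using assms by (simp add: coeff_pCons split: nat.split)
  then have nz: "?r \<noteq> 0" by (metis coeff_0 zero_neq_one)
  have deg: "degree ?r \<le> m" by (intro degree_diff_le) (auto simp: degree_monom_le)
  have eq: "{x. x ^ m = c} = {x. poly ?r x = 0}" by (simp add: poly_monom)
  show "finite {x. x ^ m = c}" unfolding eq by (rule poly_roots_finite[OF nz])
  show "card {x. x ^ m = c} \<le> m" unfolding eq using card_poly_roots_bound[OF nz] deg by simp
qed

text \<open>Multiplication by \<open>g\<close> on \<open>K[x]/(f)\<close> in the basis of the powers of \<open>x\<close>; its determinant is the norm
  of \<open>g\<close>.\<close>

definition mult_matrix :: "'a::field poly \<Rightarrow> 'a poly \<Rightarrow> 'a mat"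
  where "mult_matrix f g = mat (degree f) (degree f) (\<lambda>(i, j). coeff ((g * monom 1 j) mod f) i)"

context
  fixes f :: "'a::finite_field poly"
  assumes irr: "irreducible f" and mon: "monic f"
begin

section \<open>Evaluation in the algebraic closure and the Frobenius map\<close>

interpretation to_ac: field_hom "to_ac :: 'a \<Rightarrow> 'a alg_closure"
  by unfold_locales auto

interpretation to_ac_poly: map_poly_comm_ring_hom "to_ac :: 'a \<Rightarrow> 'a alg_closure" ..

abbreviation ev :: "'a poly \<Rightarrow> 'a alg_closure \<Rightarrow> 'a alg_closure"
  where "ev p \<beta> \<equiv> poly (map_poly to_ac p) \<beta>"

text \<open>The polynomial identity for (1 + x)^q is evaluated at x / y and multiplied by
  y^q.\<close>

lemma card_power_add:
  fixes x y :: "'a alg_closure"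
  shows "(x + y) ^ card (UNIV :: 'a set) = x ^ card (UNIV :: 'a set) + y ^ card (UNIV :: 'a set)"
proof (cases "y = 0")
  case False
  let ?q = "card (UNIV :: 'a set)"
  have "ev ([:1, 1:] ^ ?q) (x / y) = ev (monom 1 ?q + 1) (x / y)"
    by (simp only: finite_field_binomial_poly)
  then have "(1 + x / y) ^ ?q = (x / y) ^ ?q + 1"
    by (simp add: to_ac_poly.hom_power to_ac_poly.hom_add poly_monom)
  then have "y ^ ?q * (1 + x / y) ^ ?q = y ^ ?q * ((x / y) ^ ?q + 1)" by simp
  then show ?thesis
    using False by (simp add: power_mult_distrib[symmetric] distrib_left add.commute) 
qed (use finite_field_card_gt_1[where 'a = 'a] in simp)

text \<open>The coefficients lie in the field with q elements and are fixed by the q-th power, which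
  is additive; hence only the argument changes.\<close>

lemma ev_card_power: "ev p (\<beta> ^ card (UNIV :: 'a set)) = ev p \<beta> ^ card (UNIV :: 'a set)"
proof (induction p)
  case (pCons a p)
  have "to_ac a ^ card (UNIV :: 'a set) = to_ac a"
    by (metis to_ac_power finite_field_power_card_eq_same)
  then show ?case using pCons.IH by (simp add: to_ac.map_poly_pCons_hom card_power_add power_mult_distrib)
qed (use finite_field_card_gt_1[where 'a = 'a] in simp)

lemma ev_frobenius: "ev p (\<beta> ^ (card (UNIV :: 'a set) ^ l)) = ev p \<beta> ^ (card (UNIV :: 'a set) ^ l)"
  by (induction l) (simp_all add: power_mult ev_card_power mult.commute[of "card UNIV"])

lemma ev_sum: "degree p < N \<Longrightarrow> ev p \<beta> = (\<Sum>i<N. to_ac (coeff p i) * \<beta> ^ i)"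
  unfolding poly_altdef to_ac.degree_map_poly_hom
  by (rule sum.mono_neutral_cong_left) (auto simp: coeff_eq_0)

lemma ev_eq_0_iff:
  assumes "ev f \<alpha> = 0"
  shows "ev p \<alpha> = 0 \<longleftrightarrow> f dvd p"
proof
  assume 0: "ev p \<alpha> = 0"
  show "f dvd p"
  proof (rule ccontr)
    assume "\<not> f dvd p"
    then obtain u w where "u * f + w * p = 1" using irreducible_bezout[OF irr] by blast
    then have "ev (u * f + w * p) \<alpha> = 1" by simp
    then show False using assms 0 by (simp add: to_ac_poly.hom_add to_ac_poly.hom_mult)
  qed
next
  assume "f dvd p"
  then show "ev p \<alpha> = 0" using assms by (auto simp: to_ac_poly.hom_mult elim!: dvdE)
qed

context
  fixes \<alpha> :: "'a alg_closure"
  assumes root: "ev f \<alpha> = 0"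
begin

lemma ev_inj:
  assumes "degree p < degree f" "degree r < degree f" "ev p \<alpha> = ev r \<alpha>"
  shows "p = r"
proof (rule ccontr)
  assume "p \<noteq> r"
  have "ev (p - r) \<alpha> = 0" using assms(3) by (simp add: to_ac_poly.hom_minus)
  then have "f dvd p - r" using ev_eq_0_iff[OF root] by simp
  then have "degree f \<le> degree (p - r)" using \<open>p \<noteq> r\<close> by (intro dvd_imp_degree_le) auto
  then show False using degree_diff_less[OF assms(1,2)] by simp
qed

lemma card_small_polys: "card {p :: 'a poly. degree p < degree f} = card (UNIV :: 'a set) ^ degree f"
proof -
  let ?L = "{xs :: 'a list. set xs \<subseteq> UNIV \<and> length xs = degree f}"
  have co: "coeff (Poly xs) i = (if i < length xs then xs ! i else 0)" for xs :: "'a list" and i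
    by (simp add: nth_default_def)
  have "bij_betw Poly ?L {p. degree p < degree f}"
  proof (rule bij_betw_imageI)
    show "inj_on Poly ?L"
    proof (rule inj_onI)
      fix xs ys :: "'a list" assume "xs \<in> ?L" "ys \<in> ?L" and eq: "Poly xs = Poly ys"
      then have len: "length xs = degree f" "length ys = degree f" by auto
      show "xs = ys"
      proof (rule nth_equalityI)
        fix i assume "i < length xs"
        then show "xs ! i = ys ! i" using arg_cong[OF eq, of "\<lambda>p. coeff p i"] len unfolding co by simp
      qed (simp add: len)
    qed
    show "Poly ` ?L = {p. degree p < degree f}"
    proof (intro equalityI subsetI)
      fix p assume "p \<in> Poly ` ?L"
      then obtain xs where xs: "p = Poly xs" "length xs = degree f" by auto
      have "degree p \<le> degree f - 1"
        by (rule degree_le) (use xs degree_irreducible_pos[OF irr] in \<open>auto simp: nth_default_def\<close>)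
      then show "p \<in> {p. degree p < degree f}" using degree_irreducible_pos[OF irr] by simp
    next
      fix p :: "'a poly" assume "p \<in> {p. degree p < degree f}"
      then have d: "degree p < degree f" by simp
      have "p = Poly (map (coeff p) [0..<degree f])"
        by (rule poly_eqI) (use d in \<open>auto simp: nth_default_def coeff_eq_0\<close>)
      then show "p \<in> Poly ` ?L" by (rule image_eqI) simp
    qed
  qed
  from bij_betw_same_card[OF this]
  have "card {p :: 'a poly. degree p < degree f} = card ?L" by (rule sym)
  also have "\<dots> = card (UNIV :: 'a set) ^ degree f" by (rule card_lists_length_eq) simp
  finally show ?thesis .
qed

text \<open>The field generated by the root \<alpha> over the base field, each element being
  represented by a reduced polynomial.\<close>

abbreviation "evaluations \<equiv> (\<lambda>p. ev p \<alpha>) ` {p. degree p < degree f}"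

lemma card_evaluations: "card evaluations = card (UNIV :: 'a set) ^ degree f"
  by (subst card_image) (auto intro!: inj_onI ev_inj simp: card_small_polys)

text \<open>If the q^m-th power fixes \<alpha>, it fixes every polynomial expression in \<alpha>.
  Then q^d elements, with d the degree of f, would be roots of x^(q^m) - x, which has at most
  q^m.\<close>

lemma frobenius_period:
  assumes m: "0 < m" "m < degree f"
  shows "\<alpha> ^ (card (UNIV :: 'a set) ^ m) \<noteq> \<alpha>"
proof
  let ?q = "card (UNIV :: 'a set)"
  note q = finite_field_card_gt_1[where 'a = 'a]
  assume fix\<alpha>: "\<alpha> ^ (?q ^ m) = \<alpha>"
  let ?r = "monom 1 (?q ^ m) - [:0, 1:] :: 'a alg_closure poly"
  have qm: "?q ^ m > 1" using one_less_power[OF q m(1)] .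
  have "coeff [:0, 1 :: 'a alg_closure:] (?q ^ m) = 0" using qm by (intro coeff_eq_0) simp
  then have "coeff ?r (?q ^ m) = 1" by simp
  then have nz: "?r \<noteq> 0" by (metis coeff_0 zero_neq_one)
  have deg: "degree ?r \<le> ?q ^ m" using qm by (intro degree_diff_le) (auto simp: degree_monom_le)
  have "evaluations \<subseteq> {x. poly ?r x = 0}"
  proof safe
    fix p
    show "poly ?r (ev p \<alpha>) = 0"
      using ev_frobenius[of p \<alpha> m, symmetric] unfolding fix\<alpha> by (simp add: poly_monom)
  qed
  then have "card evaluations \<le> card {x. poly ?r x = 0}" by (intro card_mono poly_roots_finite nz)
  also have "\<dots> \<le> ?q ^ m" using card_poly_roots_bound[OF nz] deg by simp
  finally have "?q ^ degree f \<le> ?q ^ m" by (simp add: card_evaluations)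
  from power_le_imp_le_exp[OF q this] show False using m by simp
qed

text \<open>The q-th power is additive and only 0 has power 0; injectivity follows by writing x = (x
  - y) + y.\<close>

lemma card_power_inj:
  fixes x y :: "'a alg_closure"
  assumes "x ^ (card (UNIV :: 'a set) ^ l) = y ^ (card (UNIV :: 'a set) ^ l)"
  shows "x = y"
  using assms
proof (induction l)
  case (Suc l)
  let ?q = "card (UNIV :: 'a set)"
  have "(x ^ ?q ^ l) ^ ?q = (y ^ ?q ^ l) ^ ?q"
    using Suc.prems by (simp add: power_mult[symmetric] mult.commute)
  moreover have "(x ^ ?q ^ l) ^ ?q = ((x ^ ?q ^ l - y ^ ?q ^ l) + y ^ ?q ^ l) ^ ?q" by simp
  ultimately have "(x ^ ?q ^ l - y ^ ?q ^ l) ^ ?q = 0" unfolding card_power_add by simp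
  then show ?case using Suc.IH by simp
qed simp

lemma conjugates_inj: "inj_on (\<lambda>l. \<alpha> ^ (card (UNIV :: 'a set) ^ l)) {..<degree f}"
proof (rule linorder_inj_onI)
  let ?q = "card (UNIV :: 'a set)"
  fix i j assume ij: "i < j" "i \<in> {..<degree f}" "j \<in> {..<degree f}"
  show "\<alpha> ^ (?q ^ i) \<noteq> \<alpha> ^ (?q ^ j)"
  proof
    assume "\<alpha> ^ (?q ^ i) = \<alpha> ^ (?q ^ j)"
    moreover have "?q ^ j = ?q ^ (j - i) * ?q ^ i" using ij by (simp flip: power_add)
    ultimately have "\<alpha> ^ (?q ^ i) = (\<alpha> ^ (?q ^ (j - i))) ^ (?q ^ i)" by (simp add: power_mult)
    then have "\<alpha> = \<alpha> ^ (?q ^ (j - i))" by (rule card_power_inj)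
    then show False using frobenius_period[of "j - i"] ij by (metis lessThan_iff less_imp_diff_less zero_less_diff)
  qed
qed auto

text \<open>The Vandermonde matrix of the conjugates \<open>\<alpha>, \<alpha>\<^sup>q, \<dots>\<close> diagonalises the multiplication matrix.\<close>

lemma det_mult_matrix:
  "to_ac (det (mult_matrix f g)) = ev g \<alpha> ^ (\<Sum>l<degree f. card (UNIV :: 'a set) ^ l)"
proof -
  let ?q = "card (UNIV :: 'a set)" and ?d = "degree f"
  define A where "A = map_mat to_ac (mult_matrix f g)"
  define W where "W = mat ?d ?d (\<lambda>(l, i). (\<alpha> ^ (?q ^ l)) ^ i)"
  define D where "D = mat ?d ?d (\<lambda>(l, i). if l = i then ev g (\<alpha> ^ (?q ^ l)) else 0)"
  have carr: "A \<in> carrier_mat ?d ?d" "W \<in> carrier_mat ?d ?d" "D \<in> carrier_mat ?d ?d"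
    by (auto simp: A_def W_def D_def mult_matrix_def)
  have root': "ev f (\<alpha> ^ (?q ^ l)) = 0" for l
    by (simp add: ev_frobenius root) (use finite_field_card_gt_1[where 'a = 'a] in simp)
  \<comment> \<open>Row l of \<open>W\<close> evaluates a coefficient vector at the l-th conjugate.
    Reduction modulo f does not affect the value, as every conjugate is a root of f.\<close>
  have "W * A = D * W"
  proof (rule eq_matI)
    fix l j assume "l < dim_row (D * W)" "j < dim_col (D * W)"
    then have lj: "l < ?d" "j < ?d" using carr by auto
    let ?\<beta> = "\<alpha> ^ (?q ^ l)" and ?h = "g * monom 1 j"
    have deg: "degree (?h mod f) < ?d"
      using degree_mod_less'[of f ?h] degree_irreducible_pos[OF irr] by (cases "?h mod f = 0"; cases "f = 0") auto
    have "(W * A) $$ (l, j) = (\<Sum>i<?d. to_ac (coeff (?h mod f) i) * ?\<beta> ^ i)"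
      using lj by (simp add: A_def W_def mult_matrix_def scalar_prod_def lessThan_atLeast0 mult.commute)
    also have "\<dots> = ev (?h mod f) ?\<beta>" by (rule ev_sum[OF deg, symmetric])
    also have "\<dots> = ev (?h div f * f + ?h mod f) ?\<beta>"
      by (simp only: to_ac_poly.hom_add to_ac_poly.hom_mult poly_add poly_mult root') simp
    also have "\<dots> = ev g ?\<beta> * ?\<beta> ^ j"
      by (simp add: to_ac_poly.hom_mult poly_monom)
    also have "\<dots> = (\<Sum>i\<in>{0..<?d}. if i = l then ev g ?\<beta> * ?\<beta> ^ j else 0)" using lj by simp
    also have "\<dots> = (D * W) $$ (l, j)"
      using lj by (auto simp: D_def W_def scalar_prod_def if_distrib[of "\<lambda>x. x * _"] cong: if_cong intro!: sum.cong)
    finally show "(W * A) $$ (l, j) = (D * W) $$ (l, j)" .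
  qed (use carr in auto)
  then have "det W * det A = det D * det W"
    by (metis carr det_mult)
  moreover have "det W \<noteq> 0"
  proof
    assume "det W = 0"
    then obtain v where v: "v \<in> carrier_vec ?d" "v \<noteq> 0\<^sub>v ?d" "W *\<^sub>v v = 0\<^sub>v ?d"
      using det_0_iff_vec_prod_zero_field[OF carr(2)] by blast
    \<comment> \<open>A kernel vector of \<open>W\<close> holds the coefficients of a polynomial of
      degree below d that vanishes at d distinct conjugates.\<close>
    define p where "p = (\<Sum>i<?d. monom (v $ i) i)"
    have cp: "coeff p i = (if i < ?d then v $ i else 0)" for i by (simp add: p_def coeff_sum)
    have "p = 0"
    proof (rule ccontr)
      assume nz: "p \<noteq> 0"
      have "degree p \<le> ?d - 1" by (rule degree_le) (use degree_irreducible_pos[OF irr] in \<open>auto simp: cp\<close>)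
      have "(\<lambda>l. \<alpha> ^ (?q ^ l)) ` {..<?d} \<subseteq> {x. poly p x = 0}"
      proof safe
        fix l assume l: "l < ?d"
        have "poly p (\<alpha> ^ (?q ^ l)) = (W *\<^sub>v v) $ l"
          using l v(1) by (simp add: p_def poly_sum poly_monom W_def scalar_prod_def lessThan_atLeast0 mult.commute)
        then show "poly p (\<alpha> ^ (?q ^ l)) = 0" using l v(3) by simp
      qed
      then have "card ((\<lambda>l. \<alpha> ^ (?q ^ l)) ` {..<?d}) \<le> card {x. poly p x = 0}"
        by (intro card_mono poly_roots_finite nz)
      then have "?d \<le> degree p"
        using card_poly_roots_bound[OF nz] by (simp add: card_image[OF conjugates_inj])
      then show False using \<open>degree p \<le> ?d - 1\<close> degree_irreducible_pos[OF irr] by simp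
    qed
    then have "v = 0\<^sub>v ?d" using v(1) cp by (intro eq_vecI) (auto, metis coeff_0)
    then show False using v by simp
  qed
  ultimately have "det A = det D" by simp
  also have "det D = (\<Prod>l<?d. ev g (\<alpha> ^ (?q ^ l)))"
  proof -
    have "det D = prod_list (diag_mat D)"
      by (rule det_lower_triangular[OF _ carr(3)]) (auto simp: D_def)
    also have "\<dots> = (\<Prod>l<?d. ev g (\<alpha> ^ (?q ^ l)))"
      by (simp add: diag_mat_def D_def prod.list_conv_set_nth lessThan_atLeast0)
    finally show ?thesis .
  qed
  also have "\<dots> = ev g \<alpha> ^ (\<Sum>l<?d. ?q ^ l)"
    by (simp add: ev_frobenius power_sum)
  finally show ?thesis by (simp add: A_def to_ac.hom_det)
qed

end

text \<open>The norm is \<open>x \<mapsto> x\<^sup>e\<close> with \<open>(q - 1) e = q\<^sup>d - 1\<close>. Each of its fibres has at most \<open>e\<close> elements, so it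
  cannot miss any of the \<open>q - 1\<close> nonzero values.\<close>

lemma det_mult_matrix_surj:
  assumes "\<mu> \<noteq> 0"
  shows "\<exists>g. det (mult_matrix f g) = \<mu>"
proof (rule ccontr)
  assume no: "\<not> ?thesis"
  let ?q = "card (UNIV :: 'a set)" and ?d = "degree f"
  note q = finite_field_card_gt_1[where 'a = 'a]
  have "degree (map_poly to_ac f) > 0" using degree_irreducible_pos[OF irr] by simp
  then obtain \<alpha> where root: "ev f \<alpha> = 0" using alg_closed_imp_poly_has_root by blast
  let ?e = "\<Sum>l<?d. ?q ^ l"
  have e0: "?e > 0" using degree_irreducible_pos[OF irr] q by (intro sum_pos2[of _ 0]) auto
  let ?E = "(\<lambda>p. ev p \<alpha>) ` {p. degree p < ?d}"
  have sub: "?E - {0} \<subseteq> (\<Union>\<nu>\<in>UNIV - {0, \<mu>}. {x. x ^ ?e = to_ac \<nu>})"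
  proof
    fix x assume "x \<in> ?E - {0}"
    then obtain p where p: "x = ev p \<alpha>" "x \<noteq> 0" by auto
    have eq: "x ^ ?e = to_ac (det (mult_matrix f p))" using det_mult_matrix[OF root, of p] p by simp
    then have "det (mult_matrix f p) \<noteq> 0" using p(2) e0
      by (metis to_ac_0 power_eq_0_iff)
    then show "x \<in> (\<Union>\<nu>\<in>UNIV - {0, \<mu>}. {x. x ^ ?e = to_ac \<nu>})" using eq no by auto
  qed
  have "?q ^ ?d - 1 = card (?E - {0})"
  proof -
    have "0 \<in> ?E" using degree_irreducible_pos[OF irr] by (intro image_eqI[of _ _ 0]) auto
    then show ?thesis using card_evaluations[OF root] by simp
  qed
  also have "\<dots> \<le> card (\<Union>\<nu>\<in>UNIV - {0, \<mu>}. {x. x ^ ?e = to_ac \<nu>})"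
    by (rule card_mono[OF _ sub]) (intro finite_UN_I card_power_roots(1) e0, simp)
  also have "\<dots> \<le> (\<Sum>\<nu>\<in>UNIV - {0, \<mu>}. card {x. x ^ ?e = to_ac \<nu>})"
    by (rule card_UN_le) simp
  also have "\<dots> \<le> (\<Sum>\<nu>\<in>UNIV - {0 :: 'a, \<mu>}. ?e)"
    by (intro sum_mono card_power_roots(2) e0)
  also have "\<dots> = (?q - 2) * ?e" using assms by (simp add: card_Diff_subset numeral_2_eq_2)
  also have "\<dots> < (?q - 1) * ?e" using q e0 by simp
  also have "\<dots> = ?q ^ ?d - 1"
  proof -
    have "int (?q ^ ?d) - 1 = (int ?q - 1) * int ?e"
      using power_diff_1_eq[of "int ?q" ?d] by simp
    then have "int (?q ^ ?d - 1) = int ((?q - 1) * ?e)" using q by (simp add: of_nat_diff)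
    then show ?thesis by linarith
  qed
  finally show False by simp
qed

end

section \<open>Cyclic decomposition\<close>

context
  fixes M :: "'a::field mat" and n :: nat
  assumes M: "M \<in> carrier_mat n n"
begin

lemma act_const:
  assumes v: "v \<in> carrier_vec n"
  shows "act M [:c:] v = c \<cdot>\<^sub>v v"
  using act_smult[OF M v, of c 1] act_one[OF M v] by (simp add: one_pCons)

lemma act_X:
  assumes v: "v \<in> carrier_vec n"
  shows "act M [:0, 1:] v = M *\<^sub>v v"
proof -
  have "act M [:0, 1:] v = 0 \<cdot>\<^sub>v v + M *\<^sub>v v"
    by (subst act_pCons[OF M v]) (simp add: act_one[OF M v] flip: one_pCons)
  also have "\<dots> = M *\<^sub>v v" using M v by (intro eq_vecI) auto
  finally show ?thesis .
qed

lemma act_swap: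
  assumes v: "v \<in> carrier_vec n"
  shows "act M p (act M q v) = act M q (act M p v)"
  using act_mult[OF M v, of p q] act_mult[OF M v, of q p] by (simp add: mult.commute)

text \<open>Column m of x - M, read as coefficients of the unit vectors, says that x acts on the
  m-th unit vector as column m of M.\<close>

lemma char_poly_matrix_annihilates:
  assumes m: "m < n"
  shows "vsum n (\<lambda>l. act M (char_poly_matrix M $$ (l, m)) (unit_vec n l)) {..<n} = 0\<^sub>v n"
proof (rule eq_vecI)
  fix i assume "i < dim_vec (0\<^sub>v n :: 'a vec)"
  then have i: "i < n" by simp
  have "act M (char_poly_matrix M $$ (l, m)) (unit_vec n l) $ i
      = (if l = m then M $$ (i, m) else 0) - (if l = i then M $$ (i, m) else 0)" if "l < n" for l
  proof -
    have "char_poly_matrix M $$ (l, m) = (if l = m then [:0, 1:] else 0) + [:- M $$ (l, m):]"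
      using M that m by (simp add: char_poly_matrix_def)
    then show ?thesis
      using i that m M
      by (simp add: act_add_left[OF M] act_X act_const carrier_vecD[OF act_closed[OF M]] act_zero_left[OF M])
  qed
  then show "vsum n (\<lambda>l. act M (char_poly_matrix M $$ (l, m)) (unit_vec n l)) {..<n} $ i = 0\<^sub>v n $ i"
    using i m by (simp add: sum_subtractf)
qed simp

text \<open>The relations given by the columns of x - M are combined with the entries of its
  adjugate as weights. The product of the two matrices is the characteristic polynomial times the
  identity, so that polynomial kills each unit vector.\<close>

lemma cayley_hamilton:
  assumes v: "v \<in> carrier_vec n"
  shows "act M (char_poly M) v = 0\<^sub>v n"
proof -
  let ?C = "char_poly_matrix M"
  let ?B = "adj_mat ?C"
  let ?u = "unit_vec n :: nat \<Rightarrow> 'a vec"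
  have C: "?C \<in> carrier_mat n n" using M by (rule char_poly_matrix_closed)
  note B = adj_mat[OF C]
  have unit: "act M (char_poly M) (?u j) = 0\<^sub>v n" if j: "j < n" for j
  proof -
    have entry: "(\<Sum>m<n. ?C $$ (l, m) * ?B $$ (m, j)) = (if l = j then char_poly M else 0)" if "l < n" for l
    proof -
      have "(\<Sum>m<n. ?C $$ (l, m) * ?B $$ (m, j)) = (?C * ?B) $$ (l, j)"
        using that j C B(1) by (simp add: scalar_prod_def lessThan_atLeast0)
      then show ?thesis using that j by (simp add: B(2) char_poly_def)
    qed
    have "act M (char_poly M) (?u j)
        = vsum n (\<lambda>l. act M (if l = j then char_poly M else 0) (?u l)) {..<n}"
      using j M act_zero_left[OF M] by (subst vsum_single[of _ j]) auto
    also have "\<dots> = vsum n (\<lambda>l. vsum n (\<lambda>m. act M (?C $$ (l, m) * ?B $$ (m, j)) (?u l)) {..<n}) {..<n}"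
      by (rule vsum_cong) (auto simp: entry[symmetric] act_sum[OF M])
    also have "\<dots> = vsum n (\<lambda>m. vsum n (\<lambda>l. act M (?C $$ (l, m) * ?B $$ (m, j)) (?u l)) {..<n}) {..<n}"
      by (rule eq_vecI) (auto intro: sum.swap)
    also have "\<dots> = vsum n (\<lambda>m. act M (?B $$ (m, j)) (vsum n (\<lambda>l. act M (?C $$ (l, m)) (?u l)) {..<n})) {..<n}"
      using M by (intro vsum_cong) (auto simp: act_vsum[OF M] act_mult[OF M, symmetric] mult.commute)
    also have "\<dots> = 0\<^sub>v n"
      by (rule vsum_neutral) (use act_zero_right[OF M] in \<open>simp add: char_poly_matrix_annihilates\<close>)
    finally show ?thesis .
  qed
  \<comment> \<open>Scalars are written as constant polynomials, so that they commute with the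
    characteristic polynomial by the laws of the action.\<close>
  have "v = vsum n (\<lambda>j. act M [:v $ j:] (?u j)) {..<n}"
    using v by (intro eq_vecI) (auto simp: act_const if_distrib[of "\<lambda>x. _ * x"] unit_vec_def cong: if_cong)
  then have "act M (char_poly M) v
      = vsum n (\<lambda>j. act M (char_poly M) (act M [:v $ j:] (?u j))) {..<n}"
    using act_vsum[OF M, of "{..<n}" "\<lambda>j. act M [:v $ j:] (?u j)" "char_poly M"] M by simp
  also have "\<dots> = 0\<^sub>v n"
    by (rule vsum_neutral) (use act_zero_right[OF M] in \<open>simp add: act_swap[of _ "char_poly M"] unit\<close>)
  finally show ?thesis .
qed

end

section \<open>Monic irreducible factors of a polynomial\<close>

lemma prime_elem_dvd_prodD:
  assumes "finite A" "prime_elem p" "p dvd prod f A"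
  shows "\<exists>a\<in>A. p dvd f a"
  using assms(1,3) by (induction rule: finite_induct) (use assms(2) prime_elem_not_unit[OF assms(2)] in \<open>auto simp: prime_elem_dvd_mult_iff\<close>)

lemma monic_irreducible_dvd_eq:
  fixes f g :: "'a::field poly"
  assumes "irreducible f" "irreducible g" "monic f" "monic g" "f dvd g"
  shows "f = g"
proof -
  obtain c where c: "g = f * c" using assms(5) by (rule dvdE)
  then have "is_unit c" using Factorial_Ring.irreducibleD[OF assms(2) c] irreducible_not_unit[OF assms(1)] by blast
  then obtain b where b: "c = [:b:]" by (rule is_unit_polyE)
  have "b = lead_coeff g" unfolding c b using assms(3) by (simp add: lead_coeff_mult)
  then have "c = 1" using b assms(4) by (simp add: one_pCons)
  then show ?thesis using c by simp
qed

text \<open>After one monic irreducible factor q is split off, any other monic irreducible factor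
  divides the cofactor, which has smaller degree.\<close>

lemma finite_monic_irreducible_factors:
  fixes p :: "'a::field poly"
  assumes "p \<noteq> 0"
  shows "finite {f. monic f \<and> irreducible f \<and> f dvd p}"
  using assms
proof (induction "degree p" arbitrary: p rule: less_induct)
  case less
  show ?case
  proof (cases "degree p = 0")
    case True
    then have "is_unit p" using less.prems by (simp add: is_unit_iff_degree)
    then have "{f. monic f \<and> irreducible f \<and> f dvd p} = {}"
      using dvd_trans irreducible_not_unit by blast
    then show ?thesis by (metis finite.emptyI)
  next
    case False
    then obtain q r where q: "irreducible q" "p = q * r" "monic q"
      using irreducible_monic_factor[of p] by auto
    note dq = degree_irreducible_pos[OF q(1)]
    have r: "r \<noteq> 0" using q less.prems by auto
    have "degree r < degree p" using q(2) less.prems dq by (auto simp: degree_mult_eq)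
    then have fin: "finite {f. monic f \<and> irreducible f \<and> f dvd r}" using less.hyps r by blast
    have "{f. monic f \<and> irreducible f \<and> f dvd p} \<subseteq> insert q {f. monic f \<and> irreducible f \<and> f dvd r}"
    proof
      fix f assume "f \<in> {f. monic f \<and> irreducible f \<and> f dvd p}"
      then have f: "monic f" "irreducible f" "f dvd p" by auto
      then have "f dvd q \<or> f dvd r"
        using field_poly_irreducible_imp_prime[OF f(2)] q(2) by (metis prime_elem_dvd_multD)
      then show "f \<in> insert q {f. monic f \<and> irreducible f \<and> f dvd r}"
        using monic_irreducible_dvd_eq[OF f(2) q(1) f(1) q(3)] f by auto
    qed
    then show ?thesis using fin finite_subset by blast
  qed
qed

lemma irreducible_power_decompose:
  fixes f p :: "'a::field poly"
  assumes "irreducible f" "p \<noteq> 0"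
  shows "\<exists>m r. p = f ^ m * r \<and> \<not> f dvd r"
  using assms(2)
proof (induction "degree p" arbitrary: p rule: less_induct)
  case less
  show ?case
  proof (cases "f dvd p")
    case True
    then obtain s where s: "p = f * s" by (rule dvdE)
    have "degree s < degree p" using degree_irreducible_pos[OF assms(1)] s less.prems by (auto simp: degree_mult_eq)
    moreover have "s \<noteq> 0" using s less.prems by auto
    ultimately obtain m r where "s = f ^ m * r" "\<not> f dvd r" using less.hyps by blast
    then have "p = f ^ Suc m * r \<and> \<not> f dvd r" using s by simp
    then show ?thesis by blast
  next
    case False
    then have "p = f ^ 0 * p \<and> \<not> f dvd p" by simp
    then show ?thesis by blast
  qed
qed

section \<open>Decomposition into primary components\<close>

definition primary :: "'a::field mat \<Rightarrow> 'a poly \<Rightarrow> 'a vec set"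
  where "primary M f = carrier (primary_component M f)"

context
  fixes M :: "'a::field mat" and n :: nat
  assumes M: "M \<in> carrier_mat n n"
begin

lemma primary_iff: "v \<in> primary M f \<longleftrightarrow> v \<in> carrier_vec n \<and> (\<exists>m. act M (f ^ m) v = 0\<^sub>v n)"
  using M by (auto simp: primary_def primary_component_def matrix_module_def)

lemma primary_zero [simp]: "0\<^sub>v n \<in> primary M f"
  using act_zero_right[OF M] by (auto simp: primary_iff)

lemma primary_act:
  assumes "v \<in> primary M f"
  shows "act M p v \<in> primary M f"
proof -
  obtain m where v: "v \<in> carrier_vec n" "act M (f ^ m) v = 0\<^sub>v n" using assms by (auto simp: primary_iff)
  have "act M (f ^ m) (act M p v) = 0\<^sub>v n"
    using act_swap[OF M v(1)] v(2) act_zero_right[OF M] by simp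
  then show ?thesis using M v(1) by (auto simp: primary_iff)
qed

lemma primary_add:
  assumes "u \<in> primary M f" "v \<in> primary M f"
  shows "u + v \<in> primary M f"
proof -
  obtain k where u: "u \<in> carrier_vec n" "act M (f ^ k) u = 0\<^sub>v n" using assms by (auto simp: primary_iff)
  obtain m where v: "v \<in> carrier_vec n" "act M (f ^ m) v = 0\<^sub>v n" using assms by (auto simp: primary_iff)
  have "act M (f ^ m * f ^ k) u = 0\<^sub>v n"
    unfolding act_mult[OF M u(1)] u(2) by (rule act_zero_right[OF M])
  moreover have "act M (f ^ k * f ^ m) v = 0\<^sub>v n"
    unfolding act_mult[OF M v(1)] v(2) by (rule act_zero_right[OF M])
  ultimately have "act M (f ^ (k + m)) (u + v) = 0\<^sub>v n"
    using u v by (simp add: act_add_right[OF M] power_add mult.commute)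
  then show ?thesis using u v by (auto simp: primary_iff)
qed

lemma primary_vsum:
  assumes "finite A" "\<And>x. x \<in> A \<Longrightarrow> w x \<in> primary M f"
  shows "vsum n w A \<in> primary M f"
  using assms
proof (induction rule: finite_induct)
  case (insert x A)
  then have "w x \<in> carrier_vec n" by (auto simp: primary_iff)
  with insert show ?case by (auto simp: vsum_insert intro!: primary_add)
qed simp

text \<open>The set \<open>T\<close> stays fixed while the annihilating polynomial p shrinks. With p
  = f^m r and 1 = u f^m + w r, the vector w r v is killed by f^m, and u f^m v is killed by r, which
  has smaller degree.\<close>

lemma primary_decomposition:
  assumes "finite T" "p \<noteq> 0" "{f. monic f \<and> irreducible f \<and> f dvd p} \<subseteq> T"
    and "v \<in> carrier_vec n" "act M p v = 0\<^sub>v n"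
  shows "\<exists>w. (\<forall>f\<in>T. w f \<in> primary M f) \<and> v = vsum n w T"
  using assms(2-)
proof (induction "degree p" arbitrary: p v rule: less_induct)
  case less
  show ?case
  proof (cases "degree p = 0")
    case True
    then have "is_unit p" using less.prems by (simp add: is_unit_iff_degree)
    then obtain q where "1 = p * q" by (rule dvdE)
    then have "q * p = 1" by (simp add: mult.commute)
    then have "v = act M (q * p) v" using less.prems(3) act_one[OF M] by simp
    also have "\<dots> = 0\<^sub>v n"
      unfolding act_mult[OF M less.prems(3)] less.prems(4) by (rule act_zero_right[OF M])
    finally have "v = vsum n (\<lambda>_. 0\<^sub>v n) T" by simp
    then show ?thesis using primary_zero by (intro exI[of _ "\<lambda>_. 0\<^sub>v n"]) simp
  next
    case False
    then obtain f where f: "irreducible f" "f dvd p" "monic f"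
      using irreducible_monic_factor[of p] by auto
    obtain m r where mr: "p = f ^ m * r" "\<not> f dvd r"
      using irreducible_power_decompose[OF f(1) less.prems(1)] by blast
    have m: "m > 0" using mr f(2) by (cases m) auto
    have r: "r \<noteq> 0" using mr less.prems by auto
    have deg: "degree r < degree p" using degree_irreducible_pos[OF f(1)] mr m less.prems(1) by (auto simp: degree_mult_eq degree_power_eq)
    obtain u w where uw: "u * f ^ m + w * r = 1" using irreducible_power_bezout[OF f(1) mr(2)] by blast
    note v = less.prems(3)
    define v1 v2 where "v1 = act M (w * r) v" and "v2 = act M (u * f ^ m) v"
    have c: "v1 \<in> carrier_vec n" "v2 \<in> carrier_vec n" using M v by (auto simp: v1_def v2_def)
    have "act M (f ^ m) v1 = act M w (act M p v)"
      unfolding v1_def mr by (simp add: act_mult[OF M v, symmetric] mult_ac)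
    then have v1: "v1 \<in> primary M f" using c act_zero_right[OF M] by (auto simp: primary_iff less.prems(4))
    have "act M r v2 = act M u (act M p v)"
      unfolding v2_def mr by (simp add: act_mult[OF M v, symmetric] mult_ac)
    then have rv2: "act M r v2 = 0\<^sub>v n" using act_zero_right[OF M] less.prems(4) by simp
    have "{f. monic f \<and> irreducible f \<and> f dvd r} \<subseteq> T" using less.prems(2) mr by auto
    from less.hyps[OF deg r this c(2) rv2] obtain x where x: "\<forall>g\<in>T. x g \<in> primary M g" "v2 = vsum n x T"
      by blast
    \<comment> \<open>The decomposition of \<open>v2\<close> runs over all of \<open>T\<close> and
      may itself have a term at f, so \<open>v1\<close> is added to that term.\<close>
    define y where "y g = x g + (if g = f then v1 else 0\<^sub>v n)" for g
    have fT: "f \<in> T" using f less.prems(2) by auto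
    have "v = v1 + v2"
      using act_add_left[OF M v, of "w * r" "u * f ^ m"] uw act_one[OF M v]
      by (simp add: v1_def v2_def add.commute)
    also have "v1 = vsum n (\<lambda>g. if g = f then v1 else 0\<^sub>v n) T"
      using assms(1) fT c by (subst vsum_single[of _ f]) auto
    also have "\<dots> + v2 = v2 + \<dots>" by (rule comm_add_vec) (use c in auto)
    also have "\<dots> = vsum n y T"
      unfolding x(2) y_def by (rule vsum_add[symmetric]) (use x(1) c in \<open>auto simp: primary_iff\<close>)
    finally have "v = vsum n y T" .
    moreover have "\<forall>g\<in>T. y g \<in> primary M g" using x v1 by (auto simp: y_def intro!: primary_add)
    ultimately show ?thesis by blast
  qed
qed

text \<open>The product \<open>R\<close> of the powers that kill the other components kills the
  whole sum, hence also \<open>w f\<close>. So does a power of f, and the two are coprime.\<close>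

lemma primary_independent:
  assumes T: "finite T" "\<And>g. g \<in> T \<Longrightarrow> monic g \<and> irreducible g"
    and w: "\<And>g. g \<in> T \<Longrightarrow> w g \<in> primary M g" and sum: "vsum n w T = 0\<^sub>v n"
    and f: "f \<in> T"
  shows "w f = 0\<^sub>v n"
proof -
  have "\<forall>g\<in>T. \<exists>m. act M (g ^ m) (w g) = 0\<^sub>v n" using w by (simp add: primary_iff)
  then obtain m where m: "\<And>g. g \<in> T \<Longrightarrow> act M (g ^ m g) (w g) = 0\<^sub>v n" by metis
  have c: "\<And>g. g \<in> T \<Longrightarrow> w g \<in> carrier_vec n" using w by (simp add: primary_iff)
  define R where "R = (\<Prod>g\<in>T - {f}. g ^ m g)"
  have fi: "irreducible f" using T f by auto
  have "\<not> f dvd R"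
  proof
    assume "f dvd R"
    then obtain g where g: "g \<in> T - {f}" "f dvd g ^ m g"
      using prime_elem_dvd_prodD[OF _ field_poly_irreducible_imp_prime[OF fi], of "T - {f}"] T(1)
      unfolding R_def by blast
    then have "f dvd g" using field_poly_irreducible_imp_prime[OF fi] prime_elem_dvd_power by blast
    then show False using monic_irreducible_dvd_eq[of f g] T(2) f g(1) by auto
  qed
  then obtain u x where ux: "u * f ^ m f + x * R = 1" using irreducible_power_bezout[OF fi] by blast
  have "act M R (w g) = 0\<^sub>v n" if "g \<in> T" "g \<noteq> f" for g
  proof -
    have "g ^ m g dvd R" unfolding R_def using T(1) that by (intro dvd_prodI) auto
    then obtain y where "R = y * g ^ m g" by (metis dvdE mult.commute)
    then show ?thesis using act_mult[OF M c[OF that(1)]] m[OF that(1)] act_zero_right[OF M] by simp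
  qed
  then have "act M R (w f) = vsum n (\<lambda>g. act M R (w g)) T"
    using T(1) f c M by (subst vsum_single[of _ f]) auto
  also have "\<dots> = 0\<^sub>v n"
    using act_vsum[OF M T(1), of w R] c sum act_zero_right[OF M] by simp
  finally have R: "act M R (w f) = 0\<^sub>v n" .
  have "w f = act M (u * f ^ m f + x * R) (w f)" using ux act_one[OF M] c[OF f] by simp
  also have "\<dots> = 0\<^sub>v n"
    using c[OF f] by (simp add: act_add_left[OF M] act_mult[OF M] R m[OF f] act_zero_right[OF M])
  finally show ?thesis .
qed

end

section \<open>From the module isomorphism to generators and relations\<close>

definition coset :: "'a::field poly \<Rightarrow> 'a poly \<Rightarrow> 'a poly set"
  where "coset g p = PIdl\<^bsub>class_ring\<^esub> g +>\<^bsub>class_ring\<^esub> p"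

lemma ideal_class_ring: "ideal (PIdl\<^bsub>class_ring\<^esub> (g :: 'a::field poly)) class_ring"
  by (rule cring.cgenideal_ideal) (auto intro: class_cring.is_cring)

lemma coset_eq_iff: "coset g p = coset g q \<longleftrightarrow> g dvd p - q"
proof -
  have "p \<ominus>\<^bsub>class_ring\<^esub> q \<in> PIdl\<^bsub>class_ring\<^esub> g \<longleftrightarrow> coset g p = coset g q"
    unfolding coset_def
    by (rule ring.quotient_eq_iff_same_a_r_cos[OF class_ring.ring_axioms ideal_class_ring]) auto
  moreover have "p \<ominus>\<^bsub>class_ring\<^esub> q = p - q" by (simp add: class_ring_simps)
  moreover have "p - q \<in> PIdl\<^bsub>class_ring\<^esub> g \<longleftrightarrow> g dvd p - q"
    by (auto simp: cgenideal_def dvd_def mult.commute)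
  ultimately show ?thesis by simp
qed

lemma cyclic_module_carrier: "carrier (cyclic_module g) = range (coset g)"
  by (auto simp: cyclic_module_def Let_def FactRing_def A_RCOSETS_def' coset_def)

lemma cyclic_module_add: "coset g p \<oplus>\<^bsub>cyclic_module g\<^esub> coset g q = coset g (p + q)"
  using ideal.a_rcos_sum[OF ideal_class_ring, of p q g]
  by (simp add: cyclic_module_def Let_def FactRing_def coset_def)

lemma cyclic_module_smult: "r \<odot>\<^bsub>cyclic_module g\<^esub> coset g p = coset g (r * p)"
  using ideal.rcoset_mult_add[OF ideal_class_ring, of r p g]
  by (simp add: cyclic_module_def Let_def FactRing_def coset_def)

text \<open>The generators \<open>e j\<close> are the preimages of the tuples with 1 in place j and
  0 elsewhere. Bijectivity then turns into generation and into the divisibility conditions on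
  relations.\<close>

lemma primary_cyclic_decomposition:
  fixes M :: "'a::field mat" and r :: nat
  assumes M: "M \<in> carrier_mat n n"
    and iso: "module_isomorphic class_ring (primary_component M f)
      (finite_direct_sum {..<r} (\<lambda>j. cyclic_module (g j)))"
  shows "\<exists>e. (\<forall>j<r. e j \<in> primary M f \<and> act M (g j) (e j) = 0\<^sub>v n) \<and>
    (\<forall>v\<in>primary M f. \<exists>p. v = vsum n (\<lambda>j. act M (p j) (e j)) {..<r}) \<and>
    (\<forall>p. vsum n (\<lambda>j. act M (p j) (e j)) {..<r} = 0\<^sub>v n \<longrightarrow> (\<forall>j<r. g j dvd p j))"
proof -
  let ?S = "finite_direct_sum {..<r} (\<lambda>j. cyclic_module (g j))"
  \<comment> \<open>The element of the direct sum represented by a tuple of polynomials. Computing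
    with representatives turns equality in the direct sum into divisibility by the
    \<open>g j\<close>.\<close>
  define D where "D p = (\<lambda>j\<in>{..<r}. coset (g j) (p j))" for p
  obtain h where hom: "h \<in> LinearCombinations.module_hom class_ring (primary_component M f) ?S"
    and bij: "bij_betw h (primary M f) (carrier ?S)"
    using iso by (auto simp: module_isomorphic_def primary_def)
  have D_eq: "D p = D q \<longleftrightarrow> (\<forall>j<r. g j dvd p j - q j)" for p q
    by (auto simp: D_def fun_eq_iff coset_eq_iff restrict_def)
  have D_carrier: "D p \<in> carrier ?S" for p
    by (auto simp: D_def finite_direct_sum_def cyclic_module_carrier)
  have D_surj: "\<exists>p. x = D p" if "x \<in> carrier ?S" for x
  proof -
    have x: "x \<in> (\<Pi>\<^sub>E j\<in>{..<r}. range (coset (g j)))"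
      using that by (simp add: finite_direct_sum_def cyclic_module_carrier)
    then have "\<forall>j. \<exists>q. j < r \<longrightarrow> x j = coset (g j) q" by (auto simp: PiE_def Pi_def)
    then obtain p where "\<And>j. j < r \<Longrightarrow> x j = coset (g j) (p j)" by metis
    then have "x = D p" using x by (auto simp: D_def PiE_def extensional_def fun_eq_iff)
    then show ?thesis by blast
  qed
  have D_add: "D p \<oplus>\<^bsub>?S\<^esub> D q = D (\<lambda>j. p j + q j)" for p q
    by (auto simp: D_def finite_direct_sum_def cyclic_module_add fun_eq_iff)
  have D_smult: "s \<odot>\<^bsub>?S\<^esub> D p = D (\<lambda>j. s * p j)" for s p
    by (auto simp: D_def finite_direct_sum_def cyclic_module_smult fun_eq_iff)
  have h_add: "h (u + v) = h u \<oplus>\<^bsub>?S\<^esub> h v" if "u \<in> primary M f" "v \<in> primary M f" for u v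
    using hom that by (simp add: LinearCombinations.module_hom_def primary_def primary_component_def matrix_module_def)
  have h_act: "h (act M s v) = s \<odot>\<^bsub>?S\<^esub> h v" if "v \<in> primary M f" for s v
    using hom that by (simp add: LinearCombinations.module_hom_def primary_def primary_component_def)
  have h_carrier: "h v \<in> carrier ?S" if "v \<in> primary M f" for v
    using bij that by (rule bij_betwE[THEN bspec])
  have h_inj: "u = v" if "u \<in> primary M f" "v \<in> primary M f" "h u = h v" for u v
    using inj_onD[OF bij_betw_imp_inj_on[OF bij] that(3,1,2)] .
  \<comment> \<open>A homomorphism is only required to respect addition and scalars; that it
    respects zero follows from the action of the polynomial 0.\<close>
  have h_zero: "h (0\<^sub>v n) = D (\<lambda>_. 0)"
  proof -
    obtain p where p: "h (0\<^sub>v n) = D p" using D_surj h_carrier primary_zero[OF M] by blast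
    have "h (0\<^sub>v n) = h (act M 0 (0\<^sub>v n))" by (simp add: act_zero_right[OF M])
    also have "\<dots> = D (\<lambda>j. 0 * p j)" by (simp only: h_act[OF primary_zero[OF M]] p D_smult)
    finally show ?thesis by simp
  qed
  have "\<exists>v. v \<in> primary M f \<and> h v = D (\<lambda>i. if i = j then 1 else 0)" for j
  proof -
    have "D (\<lambda>i. if i = j then 1 else 0) \<in> h ` primary M f"
      unfolding bij_betw_imp_surj_on[OF bij] by (rule D_carrier)
    then show ?thesis by (metis imageE)
  qed
  then have "\<forall>j. \<exists>v. v \<in> primary M f \<and> h v = D (\<lambda>i. if i = j then 1 else 0)" by (rule allI)
  from choice[OF this] obtain e
    where e: "\<And>j. e j \<in> primary M f" "\<And>j. h (e j) = D (\<lambda>i. if i = j then 1 else 0)"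
    by blast
  have e_carrier: "e j \<in> carrier_vec n" for j using e(1) by (simp add: primary_iff[OF M])
  have prim: "vsum n (\<lambda>j. act M (p j) (e j)) J \<in> primary M f" if "finite J" for p J
    by (rule primary_vsum[OF M that]) (rule primary_act[OF M e(1)])
  have h_sum: "h (vsum n (\<lambda>j. act M (p j) (e j)) J) = D (\<lambda>i. if i \<in> J then p i else 0)"
    if "finite J" for p J
    using that
  proof (induction rule: finite_induct)
    case (insert j J)
    have "vsum n (\<lambda>j. act M (p j) (e j)) (insert j J)
        = act M (p j) (e j) + vsum n (\<lambda>j. act M (p j) (e j)) J"
      using insert M e_carrier by (intro vsum_insert) auto
    also have "h \<dots> = h (act M (p j) (e j)) \<oplus>\<^bsub>?S\<^esub> h (vsum n (\<lambda>j. act M (p j) (e j)) J)"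
      by (rule h_add[OF primary_act[OF M e(1)] prim[OF insert(1)]])
    also have "\<dots> = D (\<lambda>i. p j * (if i = j then 1 else 0) + (if i \<in> J then p i else 0))"
      by (simp only: h_act[OF e(1)] e(2) D_smult insert.IH D_add)
    also have "(\<lambda>i. p j * (if i = j then 1 else 0) + (if i \<in> J then p i else 0))
        = (\<lambda>i. if i \<in> insert j J then p i else 0)"
      using insert by auto
    finally show ?case .
  qed (simp add: h_zero)
  have fin: "finite {..<r}" by simp
  show ?thesis
  proof (intro exI[of _ e] conjI allI impI ballI)
    fix j assume j: "j < r"
    show "e j \<in> primary M f" by (rule e(1))
    have "h (act M (g j) (e j)) = h (0\<^sub>v n)"
      unfolding h_act[OF e(1)] e(2) D_smult h_zero D_eq by auto
    then show "act M (g j) (e j) = 0\<^sub>v n"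
      by (intro h_inj primary_act[OF M e(1)] primary_zero[OF M])
  next
    fix v assume v: "v \<in> primary M f"
    then obtain p where p: "h v = D p" using D_surj h_carrier by blast
    have "h (vsum n (\<lambda>j. act M (p j) (e j)) {..<r}) = h v"
      unfolding p h_sum[OF fin] D_eq by auto
    then have "v = vsum n (\<lambda>j. act M (p j) (e j)) {..<r}"
      by (intro h_inj v prim fin) simp
    then show "\<exists>p. v = vsum n (\<lambda>j. act M (p j) (e j)) {..<r}" by blast
  next
    fix p j assume 0: "vsum n (\<lambda>j. act M (p j) (e j)) {..<r} = 0\<^sub>v n" and j: "j < r"
    have "D (\<lambda>i. if i \<in> {..<r} then p i else 0) = D (\<lambda>_. 0)"
      using h_sum[OF fin, of p] h_zero 0 by simp
    then show "g j dvd p j" using j unfolding D_eq by auto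
  qed
qed

text \<open>K^n as the internal direct sum of the cyclic submodules generated by the e_i, with
  annihilators generated by f_i^(a_i). Several indices may share the same irreducible
  polynomial.\<close>

locale cyclic_decomposition =
  fixes M :: "'a::field mat" and n :: nat and I :: "'i set"
    and f :: "'i \<Rightarrow> 'a poly" and a :: "'i \<Rightarrow> nat" and e :: "'i \<Rightarrow> 'a vec"
  assumes M: "M \<in> carrier_mat n n" and finite_I: "finite I"
    and e_carrier: "i \<in> I \<Longrightarrow> e i \<in> carrier_vec n"
    and f_irreducible: "i \<in> I \<Longrightarrow> irreducible (f i)" and f_monic: "i \<in> I \<Longrightarrow> monic (f i)"
    and a_pos: "i \<in> I \<Longrightarrow> a i > 0"
    and generates: "v \<in> carrier_vec n \<Longrightarrow> \<exists>p. v = vsum n (\<lambda>i. act M (p i) (e i)) I"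
    and independent: "vsum n (\<lambda>i. act M (p i) (e i)) I = 0\<^sub>v n \<Longrightarrow> i \<in> I \<Longrightarrow> f i ^ a i dvd p i"
    and annihilates: "i \<in> I \<Longrightarrow> act M (f i ^ a i) (e i) = 0\<^sub>v n"

text \<open>The index (f, j) stands for the j-th part of the partition at f. Cayley-Hamilton makes
  the characteristic polynomial an annihilator, so every vector splits into primary vectors, and
  each of these is expressed in the generators of its component.\<close>

lemma cyclic_decomposition_exists:
  fixes M :: "'a::field mat"
  assumes M: "M \<in> carrier_mat n n"
    and part: "\<And>f. f \<in> irreducible_factors M \<Longrightarrow> is_primary_partition M f (part f)"
  shows "\<exists>e. cyclic_decomposition M n (SIGMA f:irreducible_factors M. {..<length (part f)})
    fst (\<lambda>(f, j). part f ! j) e"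
proof -
  let ?T = "irreducible_factors M"
  have chi: "char_poly M \<noteq> 0" using degree_monic_char_poly[OF M] by auto
  have T: "finite ?T" "\<And>f. f \<in> ?T \<Longrightarrow> monic f \<and> irreducible f"
    using finite_monic_irreducible_factors[OF chi] by (auto simp: irreducible_factors_def)
  let ?P = "\<lambda>f e. (\<forall>j<length (part f). e j \<in> primary M f \<and> act M (f ^ (part f ! j)) (e j) = 0\<^sub>v n) \<and>
    (\<forall>v\<in>primary M f. \<exists>p. v = vsum n (\<lambda>j. act M (p j) (e j)) {..<length (part f)}) \<and>
    (\<forall>p. vsum n (\<lambda>j. act M (p j) (e j)) {..<length (part f)} = 0\<^sub>v n \<longrightarrow>
      (\<forall>j<length (part f). f ^ (part f ! j) dvd p j))"
  have "\<exists>e. ?P f e" if "f \<in> ?T" for f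
    by (rule primary_cyclic_decomposition[OF M]) (use part[OF that] in \<open>simp add: is_primary_partition_def\<close>)
  then have "\<forall>f\<in>?T. \<exists>e. ?P f e" by (rule ballI)
  from bchoice[OF this] obtain e where E: "\<forall>f\<in>?T. ?P f (e f)" by (rule exE)
  have e: "\<And>f j. f \<in> ?T \<Longrightarrow> j < length (part f) \<Longrightarrow> e f j \<in> primary M f"
      "\<And>f j. f \<in> ?T \<Longrightarrow> j < length (part f) \<Longrightarrow> act M (f ^ (part f ! j)) (e f j) = 0\<^sub>v n"
      "\<And>f v. f \<in> ?T \<Longrightarrow> v \<in> primary M f \<Longrightarrow> \<exists>p. v = vsum n (\<lambda>j. act M (p j) (e f j)) {..<length (part f)}"
      "\<And>f p j. f \<in> ?T \<Longrightarrow> vsum n (\<lambda>j. act M (p j) (e f j)) {..<length (part f)} = 0\<^sub>v n \<Longrightarrow>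
        j < length (part f) \<Longrightarrow> f ^ (part f ! j) dvd p j"
    using E by simp_all
  let ?I = "SIGMA f:?T. {..<length (part f)}"
  have split: "vsum n (\<lambda>i. act M (p i) (case i of (f, j) \<Rightarrow> e f j)) ?I
      = vsum n (\<lambda>f. vsum n (\<lambda>j. act M (p (f, j)) (e f j)) {..<length (part f)}) ?T" for p
    using vsum_Sigma[OF T(1), of "\<lambda>f. {..<length (part f)}" n "\<lambda>f j. act M (p (f, j)) (e f j)"]
    by (simp add: split_def)
  have "cyclic_decomposition M n ?I fst (\<lambda>(f, j). part f ! j) (\<lambda>(f, j). e f j)"
  proof
    show "M \<in> carrier_mat n n" by (rule M)
    show "finite ?I" using T by auto
    show "(case i of (f, j) \<Rightarrow> e f j) \<in> carrier_vec n" if "i \<in> ?I" for i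
      using that e(1) by (auto simp: primary_iff[OF M])
    show "irreducible (fst i)" "monic (fst i)" if "i \<in> ?I" for i using that T(2) by auto
    show "(case i of (f, j) \<Rightarrow> part f ! j) > 0" if "i \<in> ?I" for i
      using that part by (auto simp: is_primary_partition_def is_partition_def)
    show "act M (fst i ^ (case i of (f, j) \<Rightarrow> part f ! j)) (case i of (f, j) \<Rightarrow> e f j) = 0\<^sub>v n"
      if "i \<in> ?I" for i using that e(2) by auto
  next
    fix v :: "'a vec" assume v: "v \<in> carrier_vec n"
    obtain w where w: "\<forall>f\<in>?T. w f \<in> primary M f" "v = vsum n w ?T"
      using primary_decomposition[OF M T(1) chi _ v cayley_hamilton[OF M v]]
      by (auto simp: irreducible_factors_def)
    have "\<forall>f. \<exists>p. f \<in> ?T \<longrightarrow> w f = vsum n (\<lambda>j. act M (p j) (e f j)) {..<length (part f)}"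
      using e(3) w(1) by blast
    then obtain p where p: "\<And>f. f \<in> ?T \<Longrightarrow> w f = vsum n (\<lambda>j. act M (p f j) (e f j)) {..<length (part f)}"
      by metis
    have "v = vsum n (\<lambda>i. act M (case i of (f, j) \<Rightarrow> p f j) (case i of (f, j) \<Rightarrow> e f j)) ?I"
      unfolding split w(2) by (rule vsum_cong) (simp_all add: p)
    then show "\<exists>p. v = vsum n (\<lambda>i. act M (p i) (case i of (f, j) \<Rightarrow> e f j)) ?I" by blast
  next
    fix p i assume 0: "vsum n (\<lambda>i. act M (p i) (case i of (f, j) \<Rightarrow> e f j)) ?I = 0\<^sub>v n" and i: "i \<in> ?I"
    obtain f j where fj: "i = (f, j)" "f \<in> ?T" "j < length (part f)" using i by auto
    \<comment> \<open>The partial sum belonging to one f is a primary vector, so the vanishing of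
      the total forces each partial sum to vanish.\<close>
    have "vsum n (\<lambda>j. act M (p (f, j)) (e f j)) {..<length (part f)} = 0\<^sub>v n"
      by (rule primary_independent[OF M T _ _ fj(2), where w = "\<lambda>f. vsum n (\<lambda>j. act M (p (f, j)) (e f j)) {..<length (part f)}"])
        (use 0 in \<open>auto simp: split intro!: primary_vsum[OF M] primary_act[OF M] e(1)\<close>)
    from e(4)[OF fj(2) this fj(3)]
    show "fst i ^ (case i of (f, j) \<Rightarrow> part f ! j) dvd p i" by (simp add: fj)
  qed
  then show ?thesis by blast
qed

section \<open>The determinant of a commuting matrix\<close>

text \<open>Digits of p in base f u, taken modulo f^a. The lowest digit is the remainder modulo f,
  as in base f; it is recorded because the diagonal blocks of the determinant consist of lowest
  digits.\<close>

lemma adic_expansion: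
  fixes f u :: "'a::field poly"
  assumes f: "irreducible f" and u: "\<not> f dvd u"
  shows "\<exists>C. (\<forall>s. degree (C s) < degree f) \<and> (a > 0 \<longrightarrow> C 0 = p mod f) \<and>
    f ^ a dvd p - (\<Sum>s<a. (f * u) ^ s * C s)"
proof (induction a arbitrary: p)
  case 0
  show ?case using degree_irreducible_pos[OF f] by (intro exI[of _ "\<lambda>_. 0"]) simp
next
  case (Suc a)
  have f0: "f \<noteq> 0" "degree f > 0" using f degree_irreducible_pos by auto
  obtain x w where xw: "x * f ^ a + w * u = 1" using irreducible_power_bezout[OF f u] by blast
  define q where "q = p div f"
  \<comment> \<open>As w inverts u modulo f^a, the quotient q agrees with u (w q) there, so the
    remaining digits are those of w q.\<close>
  obtain C where C: "\<And>s. degree (C s) < degree f" "f ^ a dvd w * q - (\<Sum>s<a. (f * u) ^ s * C s)"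
    using Suc.IH[of "w * q"] by blast
  let ?S = "\<Sum>s<a. (f * u) ^ s * C s"
  define C' where "C' s = (case s of 0 \<Rightarrow> p mod f | Suc s \<Rightarrow> C s)" for s
  have deg: "degree (p mod f) < degree f"
    using degree_mod_less'[of f p] f0 by (cases "p mod f = 0") auto
  have p: "p = p mod f + f * q" by (simp add: q_def)
  have "(\<Sum>s<Suc a. (f * u) ^ s * C' s) = p mod f + f * u * ?S"
    by (simp del: sum.lessThan_Suc add: sum.lessThan_Suc_shift C'_def sum_distrib_left mult_ac)
  then have "p - (\<Sum>s<Suc a. (f * u) ^ s * C' s) = f * (q * 1 - u * ?S)"
    by (subst p) (simp add: algebra_simps)
  also have "\<dots> = f * (q * x * f ^ a + u * (w * q - ?S))"
    unfolding xw[symmetric] by (simp add: algebra_simps)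
  finally have eq: "p - (\<Sum>s<Suc a. (f * u) ^ s * C' s) = f * (q * x * f ^ a + u * (w * q - ?S))" .
  have "f ^ Suc a dvd p - (\<Sum>s<Suc a. (f * u) ^ s * C' s)"
    unfolding eq power_Suc by (intro mult_dvd_mono dvd_refl dvd_add dvd_mult C(2))
  moreover have "degree (C' s) < degree f" for s using deg C(1) by (simp add: C'_def split: nat.split)
  moreover have "C' 0 = p mod f" by (simp add: C'_def)
  ultimately show ?case by blast
qed

text \<open>Modulo f only the lowest digit survives, and it is too short to be a nonzero multiple of
  f. Then one factor f cancels, u is inverted modulo the remaining power, and the digits move down
  by one place.\<close>

lemma adic_expansion_unique:
  fixes f u :: "'a::field poly"
  assumes f: "irreducible f" and u: "\<not> f dvd u"
    and "\<And>s. s < a \<Longrightarrow> degree (C s) < degree f"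
    and "f ^ a dvd (\<Sum>s<a. (f * u) ^ s * C s)" and "s < a"
  shows "C s = 0"
  using assms(3-)
proof (induction a arbitrary: C s)
  case (Suc a)
  let ?S = "\<Sum>s<a. (f * u) ^ s * C (Suc s)"
  have f0: "f \<noteq> 0" using f by auto
  have eq: "(\<Sum>s<Suc a. (f * u) ^ s * C s) = C 0 + f * (u * ?S)"
    by (simp del: sum.lessThan_Suc add: sum.lessThan_Suc_shift sum_distrib_left mult_ac)
  have "f dvd C 0 + f * (u * ?S)" using Suc.prems(2) unfolding eq by (rule dvd_trans[rotated]) simp
  then have "f dvd C 0" by (simp add: dvd_add_left_iff)
  then have C0: "C 0 = 0" using Suc.prems(1)[of 0] dvd_imp_degree_le[of f "C 0"] by (meson leD zero_less_Suc)
  then have "f * f ^ a dvd f * (u * ?S)" using Suc.prems(2) unfolding eq by simp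
  then have *: "f ^ a dvd u * ?S" using f0 by simp
  obtain x w where xw: "x * f ^ a + w * u = 1" using irreducible_power_bezout[OF f u] by blast
  have "?S = (x * f ^ a + w * u) * ?S" by (simp add: xw)
  also have "\<dots> = (x * ?S) * f ^ a + w * (u * ?S)" by (simp add: algebra_simps)
  finally have S: "?S = (x * ?S) * f ^ a + w * (u * ?S)" .
  have dvdS: "f ^ a dvd ?S" by (subst S) (intro dvd_add dvd_mult * dvd_refl)
  have "C (Suc s) = 0" if "s < a" for s
    by (rule Suc.IH[OF _ dvdS that]) (simp add: Suc.prems(1))
  then show ?case using C0 Suc.prems(3) by (cases s) auto
qed simp

text \<open>Multiplication by h^s moves each digit up by s places; a digit that reaches place a or
  beyond carries a factor h^a, hence f^a.\<close>

lemma truncated_shift_dvd: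
  fixes h :: "'a::field poly"
  assumes "f dvd h"
  shows "f ^ a dvd (\<Sum>s'<a. h ^ (s + s') * C s') - (\<Sum>s''<a. h ^ s'' * (if s \<le> s'' then C (s'' - s) else 0))"
proof -
  have "(\<Sum>s''<a. h ^ s'' * (if s \<le> s'' then C (s'' - s) else 0))
      = (\<Sum>s''\<in>{s..<a}. h ^ s'' * C (s'' - s))"
    by (rule sum.mono_neutral_cong_right) auto
  also have "\<dots> = (\<Sum>s'\<in>{s'. s' < a \<and> s + s' < a}. h ^ (s + s') * C s')"
    by (rule sum.reindex_bij_witness[of _ "\<lambda>s'. s + s'" "\<lambda>s''. s'' - s"]) auto
  also have "\<dots> = (\<Sum>s'<a. if s + s' < a then h ^ (s + s') * C s' else 0)"
    by (rule sum.mono_neutral_cong_left) auto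
  finally have "(\<Sum>s'<a. h ^ (s + s') * C s') - (\<Sum>s''<a. h ^ s'' * (if s \<le> s'' then C (s'' - s) else 0))
      = (\<Sum>s'<a. if s + s' < a then 0 else h ^ (s + s') * C s')"
    by (simp add: sum_subtractf[symmetric] if_distrib cong: if_cong)
  moreover have "f ^ a dvd h ^ m" if "a \<le> m" for m
    using assms that by (meson dvd_power_le)
  ultimately show ?thesis by (auto intro!: dvd_sum dvd_mult2)
qed

lemma mat_eqI_mult_vec:
  assumes "A \<in> carrier_mat m n" "B \<in> carrier_mat m n"
    and "\<And>v. v \<in> carrier_vec n \<Longrightarrow> A *\<^sub>v v = (B :: 'a::comm_ring_1 mat) *\<^sub>v v"
  shows "A = B"
proof (rule eq_matI)
  fix i j assume "i < dim_row B" "j < dim_col B"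
  then have ij: "i < m" "j < n" using assms by auto
  have "(A *\<^sub>v unit_vec n j) $ i = (B *\<^sub>v unit_vec n j) $ i" using assms(3) by simp
  then show "A $$ (i, j) = B $$ (i, j)" using ij assms(1,2) by simp
qed (use assms in auto)

context cyclic_decomposition
begin

lemmas act_simps = act_mult[OF M] act_add_left[OF M] act_add_right[OF M] act_vsum[OF M]

lemma act_e_carrier [simp]: "i \<in> I \<Longrightarrow> act M p (e i) \<in> carrier_vec n"
  using M e_carrier by simp

lemma act_e_cong:
  assumes i: "i \<in> I" and dvd: "f i ^ a i dvd p - q"
  shows "act M p (e i) = act M q (e i)"
proof -
  obtain r where "p - q = f i ^ a i * r" using dvd by (rule dvdE)
  then have "p = q + r * f i ^ a i" by (simp add: algebra_simps)
  then show ?thesis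
    using i by (simp add: act_simps e_carrier annihilates act_zero_right[OF M])
qed

lemma independent_diff:
  assumes eq: "vsum n (\<lambda>i. act M (p i) (e i)) I = vsum n (\<lambda>i. act M (q i) (e i)) I" and i: "i \<in> I"
  shows "f i ^ a i dvd p i - q i"
proof (rule independent[OF _ i])
  have "act M (p j) (e j) = act M (p j - q j) (e j) + act M (q j) (e j)" if "j \<in> I" for j
    using act_add_left[OF M e_carrier[OF that], of "p j - q j" "q j"] by simp
  then have "vsum n (\<lambda>i. act M (p i) (e i)) I
      = vsum n (\<lambda>i. act M (p i - q i) (e i)) I + vsum n (\<lambda>i. act M (q i) (e i)) I"
    by (subst vsum_add[symmetric]) (auto intro: vsum_cong)
  then have sum: "vsum n (\<lambda>i. act M (q i) (e i)) I
      = vsum n (\<lambda>i. act M (p i - q i) (e i)) I + vsum n (\<lambda>i. act M (q i) (e i)) I"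
    unfolding eq .
  have "vsum n (\<lambda>i. act M (p i - q i) (e i)) I $ l = 0" if "l < n" for l
    using arg_cong[OF sum, of "\<lambda>v. v $ l"] that by simp
  then show "vsum n (\<lambda>i. act M (p i - q i) (e i)) I = 0\<^sub>v n" by (intro eq_vecI) auto
qed

text \<open>Acting by the radical \<open>h\<close> of the minimal polynomial gives the filtration \<open>h\<^sup>s K\<^sup>n\<close>, which
  every matrix commuting with \<open>M\<close> preserves.\<close>

definition h :: "'a poly" where "h = \<Prod>(f ` I)"

text \<open>The product defining \<open>h\<close> runs over the set of values of \<open>f\<close>,
  so a polynomial shared by several summands enters once and the cofactor is prime to it.\<close>

lemma h_decompose:
  assumes i: "i \<in> I"
  obtains u where "h = f i * u" "\<not> f i dvd u"
proof
  let ?u = "\<Prod>(f ` I - {f i})"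
  show "h = f i * ?u" unfolding h_def using i finite_I by (simp add: prod.remove[of "f ` I" "f i"])
  show "\<not> f i dvd ?u"
  proof
    assume "f i dvd ?u"
    then obtain g where g: "g \<in> f ` I - {f i}" "f i dvd g"
      using prime_elem_dvd_prodD[of "f ` I - {f i}" "f i" "\<lambda>x. x"] finite_I
        field_poly_irreducible_imp_prime[OF f_irreducible[OF i]] by auto
    then show False using monic_irreducible_dvd_eq[of "f i" g] i f_irreducible f_monic by auto
  qed
qed

section \<open>A basis adapted to the filtration\<close>

definition indices :: "'i list"
  where "indices = (SOME js. set js = I \<and> distinct js)"

lemma indices: "set indices = I" "distinct indices"
  using someI_ex[OF finite_distinct_list[OF finite_I]] unfolding indices_def by auto

text \<open>A crude common bound for the parts; unlike a maximum, a sum also makes sense for an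
  empty index set.\<close>

definition height :: nat where "height = (\<Sum>i\<in>I. a i)"

lemma a_le_height: "i \<in> I \<Longrightarrow> a i \<le> height"
  unfolding height_def using finite_I by (intro member_le_sum) auto

text \<open>Labels for a basis of h^s K^n / h^(s+1) K^n: a summand with s < a_i contributes a copy
  of K[x]/(f_i), spanned by powers of x, and any other summand contributes nothing. Two values of s
  that select the same summands give the same list.\<close>

definition level :: "nat \<Rightarrow> ('i \<times> nat) list"
  where "level s = concat (map (\<lambda>i. map (Pair i) [0..<degree (f i)]) (filter (\<lambda>i. s < a i) indices))"

lemma set_level: "set (level s) = {(i, t). i \<in> I \<and> s < a i \<and> t < degree (f i)}"
  by (auto simp: level_def indices)

lemma distinct_level: "distinct (level s)"
proof -
  have "distinct (concat (map (\<lambda>i. map (Pair i) [0..<degree (f i)]) js))" if "distinct js" for js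
    using that by (induction js) (auto simp: distinct_map inj_on_def)
  then show ?thesis unfolding level_def using indices by simp
qed

text \<open>Ordered by s, so that preserving the filtration becomes block triangularity.\<close>

definition basis_indices :: "(('i \<times> nat) \<times> nat) list"
  where "basis_indices = concat (map (\<lambda>s. map (\<lambda>c. (c, s)) (level s)) [0..<height])"

definition basis_vector :: "('i \<times> nat) \<times> nat \<Rightarrow> 'a vec"
  where "basis_vector = (\<lambda>((i, t), s). act M (h ^ s * monom 1 t) (e i))"

lemma set_basis_indices: "set basis_indices = {((i, t), s). i \<in> I \<and> s < a i \<and> t < degree (f i)}"
proof (intro equalityI subsetI)
  fix x assume "x \<in> {((i, t), s). i \<in> I \<and> s < a i \<and> t < degree (f i)}"
  then obtain i t s where x: "x = ((i, t), s)" "i \<in> I" "s < a i" "t < degree (f i)" by auto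
  then have "s \<in> {0..<height}" "x \<in> (\<lambda>c. (c, s)) ` set (level s)"
    using a_le_height[of i] by (auto simp: set_level)
  then show "x \<in> set basis_indices" unfolding basis_indices_def set_concat by auto
qed (auto simp: basis_indices_def set_level)

lemma distinct_basis_indices: "distinct basis_indices"
proof -
  have "distinct (concat (map (\<lambda>s. map (\<lambda>c. (c, s)) (level s)) js))" if "distinct js" for js
    using that by (induction js) (auto simp: distinct_map inj_on_def distinct_level)
  then show ?thesis unfolding basis_indices_def by simp
qed

lemma basis_vector_carrier: "x \<in> set basis_indices \<Longrightarrow> basis_vector x \<in> carrier_vec n"
  by (auto simp: set_basis_indices basis_vector_def)

text \<open>Collecting the terms of one generator e_i turns coordinates into the digits of a
  polynomial in base h. Spanning and independence thus become existence and uniqueness of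
  digits.\<close>

lemma vsum_basis:
  "vsum n (\<lambda>x. y x \<cdot>\<^sub>v basis_vector x) (set basis_indices)
    = vsum n (\<lambda>i. act M (\<Sum>s<a i. h ^ s * (\<Sum>t<degree (f i). monom (y ((i, t), s)) t)) (e i)) I"
proof (rule eq_vecI)
  fix l assume "l < dim_vec (vsum n (\<lambda>i. act M (\<Sum>s<a i. h ^ s * (\<Sum>t<degree (f i). monom (y ((i, t), s)) t)) (e i)) I)"
  then have l: "l < n" by simp
  have "vsum n (\<lambda>x. y x \<cdot>\<^sub>v basis_vector x) (set basis_indices) $ l
      = (\<Sum>x\<in>set basis_indices. y x * basis_vector x $ l)"
    using l by (auto simp: carrier_vecD[OF basis_vector_carrier] intro!: sum.cong)
  also have "\<dots> = (\<Sum>(i, s, t)\<in>(SIGMA i:I. {..<a i} \<times> {..<degree (f i)}). y ((i, t), s) * basis_vector ((i, t), s) $ l)"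
    by (rule sum.reindex_bij_witness[of _ "\<lambda>(i, s, t). ((i, t), s)" "\<lambda>((i, t), s). (i, s, t)"])
      (auto simp: set_basis_indices)
  also have "\<dots> = (\<Sum>i\<in>I. \<Sum>s<a i. \<Sum>t<degree (f i). y ((i, t), s) * basis_vector ((i, t), s) $ l)"
    by (simp only: sum.cartesian_product) (rule sum.Sigma[symmetric], use finite_I in auto)
  also have "\<dots> = (\<Sum>i\<in>I. act M (\<Sum>s<a i. h ^ s * (\<Sum>t<degree (f i). monom (y ((i, t), s)) t)) (e i) $ l)"
  proof (rule sum.cong[OF refl])
    fix i assume i: "i \<in> I"
    have "act M (h ^ s * monom (y ((i, t), s)) t) (e i) $ l = y ((i, t), s) * basis_vector ((i, t), s) $ l" for s t
    proof -
      have "h ^ s * monom (y ((i, t), s)) t = smult (y ((i, t), s)) (h ^ s * monom 1 t)"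
        by (subst mult_smult_right[symmetric]) (simp add: smult_monom)
      then show ?thesis
        using l by (simp add: act_smult[OF M e_carrier[OF i]] basis_vector_def carrier_vecD[OF act_e_carrier[OF i]])
    qed
    then show "(\<Sum>s<a i. \<Sum>t<degree (f i). y ((i, t), s) * basis_vector ((i, t), s) $ l)
        = act M (\<Sum>s<a i. h ^ s * (\<Sum>t<degree (f i). monom (y ((i, t), s)) t)) (e i) $ l"
      using l i by (simp add: sum_distrib_left act_sum[OF M] e_carrier)
  qed
  finally show "vsum n (\<lambda>x. y x \<cdot>\<^sub>v basis_vector x) (set basis_indices) $ l
      = vsum n (\<lambda>i. act M (\<Sum>s<a i. h ^ s * (\<Sum>t<degree (f i). monom (y ((i, t), s)) t)) (e i)) I $ l"
    using l by simp
qed simp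

lemma sum_monom_coeff: "degree p < d \<Longrightarrow> (\<Sum>t<d. monom (coeff p t) t) = p"
  by (rule poly_eqI) (auto simp: coeff_sum coeff_eq_0)

lemma coeff_sum_monom: "coeff (\<Sum>t<d. monom (y t) t) k = (if k < d then y k else 0)"
  by (simp add: coeff_sum)

lemma expansion_exists:
  "\<exists>C. \<forall>i\<in>I. (\<forall>s. degree (C i s) < degree (f i)) \<and> C i 0 = p i mod f i \<and>
    f i ^ a i dvd p i - (\<Sum>s<a i. h ^ s * C i s)"
proof -
  have "\<exists>C. (\<forall>s. degree (C s) < degree (f i)) \<and> C 0 = p i mod f i \<and>
    f i ^ a i dvd p i - (\<Sum>s<a i. h ^ s * C s)" if i: "i \<in> I" for i
  proof -
    obtain u where u: "h = f i * u" "\<not> f i dvd u" using h_decompose[OF i] .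
    show ?thesis
      using adic_expansion[OF f_irreducible[OF i] u(2), of "a i" "p i"] a_pos[OF i] unfolding u(1) by auto
  qed
  then have "\<forall>i\<in>I. \<exists>C. (\<forall>s. degree (C s) < degree (f i)) \<and> C 0 = p i mod f i \<and>
    f i ^ a i dvd p i - (\<Sum>s<a i. h ^ s * C s)" by (rule ballI)
  from bchoice[OF this] show ?thesis by simp
qed

lemma is_basis_basis_vector: "is_basis n basis_vector basis_indices"
  unfolding is_basis_def
proof (intro conjI allI impI ballI distinct_basis_indices basis_vector_carrier)
  fix v :: "'a vec" assume "v \<in> carrier_vec n"
  then obtain p where p: "v = vsum n (\<lambda>i. act M (p i) (e i)) I" using generates by blast
  obtain C where C: "\<forall>i\<in>I. (\<forall>s. degree (C i s) < degree (f i)) \<and> C i 0 = p i mod f i \<and>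
      f i ^ a i dvd p i - (\<Sum>s<a i. h ^ s * C i s)"
    using expansion_exists by (rule exE)
  have "v = vsum n (\<lambda>x. (case x of ((i, t), s) \<Rightarrow> coeff (C i s) t) \<cdot>\<^sub>v basis_vector x) (set basis_indices)"
    unfolding vsum_basis p
    by (rule vsum_cong) (use C in \<open>auto simp: sum_monom_coeff intro!: act_e_cong\<close>)
  then show "\<exists>y. v = vsum n (\<lambda>x. y x \<cdot>\<^sub>v basis_vector x) (set basis_indices)" by blast
next
  fix y x assume 0: "vsum n (\<lambda>x. y x \<cdot>\<^sub>v basis_vector x) (set basis_indices) = 0\<^sub>v n"
    and x: "x \<in> set basis_indices"
  obtain i t s where its: "x = ((i, t), s)" "i \<in> I" "s < a i" "t < degree (f i)"
    using x by (auto simp: set_basis_indices)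
  obtain u where u: "h = f i * u" "\<not> f i dvd u" using h_decompose[OF its(2)] .
  let ?C = "\<lambda>s. \<Sum>t<degree (f i). monom (y ((i, t), s)) t"
  have "degree (?C s) \<le> degree (f i) - 1" for s
    by (rule degree_le) (auto simp: coeff_sum_monom)
  then have deg: "degree (?C s) < degree (f i)" for s
    using degree_irreducible_pos[OF f_irreducible[OF its(2)]] using le_less_trans by fastforce
  have "f i ^ a i dvd (\<Sum>s<a i. (f i * u) ^ s * ?C s)"
    using independent[OF 0[unfolded vsum_basis] its(2)] unfolding u(1) .
  then have "?C s = 0"
    by (rule adic_expansion_unique[OF f_irreducible[OF its(2)] u(2) deg _ its(3)])
  then show "y x = 0" using coeff_sum_monom[of "\<lambda>t. y ((i, t), s)" "degree (f i)" t] its by simp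
qed

text \<open>In the basis \<open>h\<^sup>s x\<^sup>t e\<^sub>i\<close> the matrix of \<open>Y\<close> is block triangular with respect to \<open>s\<close>; its coefficients are
  shifted copies of those of \<open>Y x\<^sup>t e\<^sub>i\<close>, so the diagonal block at \<open>s\<close> depends on \<open>s\<close> only through the set
  of \<open>i\<close> with \<open>s < a i\<close>.\<close>

lemma det_commuting:
  assumes Y: "Y \<in> carrier_mat n n" "Y * M = M * Y"
    and P: "\<And>i t. i \<in> I \<Longrightarrow> t < degree (f i) \<Longrightarrow>
      Y *\<^sub>v act M (monom 1 t) (e i) = vsum n (\<lambda>j. act M (P (i, t) j) (e j)) I"
  shows "det Y = (\<Prod>s<height. list_det (level s) (\<lambda>(j, r) c. coeff (P c j mod f j) r))"
proof -
  have "\<forall>c. \<exists>C. \<forall>i\<in>I. (\<forall>s. degree (C i s) < degree (f i)) \<and> C i 0 = P c i mod f i \<and>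
    f i ^ a i dvd P c i - (\<Sum>s<a i. h ^ s * C i s)"
    using expansion_exists by (rule allI)
  from choice[OF this] obtain C where "\<forall>c. \<forall>i\<in>I. (\<forall>s. degree (C c i s) < degree (f i)) \<and>
      C c i 0 = P c i mod f i \<and> f i ^ a i dvd P c i - (\<Sum>s<a i. h ^ s * C c i s)"
    by (rule exE)
  then have C: "\<And>c i s. i \<in> I \<Longrightarrow> degree (C c i s) < degree (f i)"
    "\<And>c i. i \<in> I \<Longrightarrow> C c i 0 = P c i mod f i"
    "\<And>c i. i \<in> I \<Longrightarrow> f i ^ a i dvd P c i - (\<Sum>s<a i. h ^ s * C c i s)" by (simp_all del: split_paired_All)
  define A where "A = (\<lambda>((j, r), s'') (c, s). if s \<le> s'' then coeff (C c j (s'' - s)) r else 0)"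
  have "det Y = list_det basis_indices A"
  proof (rule det_in_basis[OF is_basis_basis_vector Y(1)])
    fix x assume "x \<in> set basis_indices"
    then obtain i t s where its: "x = ((i, t), s)" "i \<in> I" "s < a i" "t < degree (f i)"
      by (auto simp: set_basis_indices)
    let ?c = "(i, t)"
    have "Y *\<^sub>v basis_vector x = act M (h ^ s) (Y *\<^sub>v act M (monom 1 t) (e i))"
      using Y M its by (simp add: basis_vector_def act_simps e_carrier act_commute[OF M Y])
    also have "\<dots> = vsum n (\<lambda>j. act M (h ^ s * P ?c j) (e j)) I"
      using finite_I by (simp add: P its act_simps) (rule vsum_cong, auto simp: act_simps e_carrier)
    also have "\<dots> = vsum n (\<lambda>j. act M (\<Sum>s''<a j. h ^ s'' *
        (\<Sum>r<degree (f j). monom (A ((j, r), s'') x) r)) (e j)) I"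
    proof (rule vsum_cong[OF refl act_e_cong])
      fix j assume j: "j \<in> I"
      have inner: "(\<Sum>r<degree (f j). monom (A ((j, r), s'') x) r)
          = (if s \<le> s'' then C ?c j (s'' - s) else 0)" for s''
        using C(1)[OF j] by (simp add: A_def its sum_monom_coeff)
      obtain u where u: "h = f j * u" using h_decompose[OF j] .
      \<comment> \<open>Two errors are made in replacing h^s P by shifted digits: the error of the
        expansion, multiplied by h^s, and the digits pushed beyond place a_j. Both vanish modulo
        f_j^(a_j).\<close>
      have "f j ^ a j dvd h ^ s * (P ?c j - (\<Sum>s<a j. h ^ s * C ?c j s))"
        by (intro dvd_mult C(3) j)
      moreover have "f j ^ a j dvd (\<Sum>s'<a j. h ^ (s + s') * C ?c j s')
          - (\<Sum>s''<a j. h ^ s'' * (if s \<le> s'' then C ?c j (s'' - s) else 0))"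
        by (rule truncated_shift_dvd) (simp add: u)
      ultimately have "f j ^ a j dvd h ^ s * (P ?c j - (\<Sum>s<a j. h ^ s * C ?c j s)) +
          ((\<Sum>s'<a j. h ^ (s + s') * C ?c j s')
          - (\<Sum>s''<a j. h ^ s'' * (if s \<le> s'' then C ?c j (s'' - s) else 0)))"
        by (rule dvd_add)
      also have "h ^ s * (P ?c j - (\<Sum>s<a j. h ^ s * C ?c j s)) +
          ((\<Sum>s'<a j. h ^ (s + s') * C ?c j s')
          - (\<Sum>s''<a j. h ^ s'' * (if s \<le> s'' then C ?c j (s'' - s) else 0)))
        = h ^ s * P ?c j - (\<Sum>s''<a j. h ^ s'' * (if s \<le> s'' then C ?c j (s'' - s) else 0))"
        by (simp add: right_diff_distrib sum_distrib_left power_add mult.assoc)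
      finally show "f j ^ a j dvd h ^ s * P ?c j - (\<Sum>s''<a j. h ^ s'' *
        (\<Sum>r<degree (f j). monom (A ((j, r), s'') x) r))" unfolding inner .
    qed
    also have "\<dots> = vsum n (\<lambda>z. A z x \<cdot>\<^sub>v basis_vector z) (set basis_indices)"
      by (rule vsum_basis[symmetric])
    finally show "Y *\<^sub>v basis_vector x = vsum n (\<lambda>z. A z x \<cdot>\<^sub>v basis_vector z) (set basis_indices)" .
  qed
  also have "\<dots> = (\<Prod>s<height. list_det (map (\<lambda>c. (c, s)) (level s)) A)"
    unfolding basis_indices_def
    by (rule list_det_concat_triangular) (auto simp: A_def)
  \<comment> \<open>In a diagonal block the shift is zero, so the entries come from the lowest
    digit, which is the remainder of P modulo f_j.\<close>
  also have "\<dots> = (\<Prod>s<height. list_det (level s) (\<lambda>(j, r) c. coeff (P c j mod f j) r))"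
    unfolding list_det_map
    by (intro prod.cong list_det_cong refl) (auto simp: A_def set_level C(2))
  finally show ?thesis .
qed

end

section \<open>The determinants that occur\<close>

text \<open>Bezout's identity is applied one index at a time: \<theta>^u goes to the new index and
  \<theta>^v is passed on to the others. Since u and v may be negative, integer powers of a nonzero
  \<theta> are used.\<close>

lemma power_product_eq_power_Gcd:
  fixes \<theta> :: "'a::field" and a :: "'i \<Rightarrow> nat"
  assumes "finite I" "\<theta> \<noteq> 0"
  shows "\<exists>\<mu>. (\<forall>i\<in>I. \<mu> i \<noteq> 0) \<and> (\<Prod>i\<in>I. \<mu> i ^ a i) = \<theta> ^ Gcd (a ` I)"
  using assms
proof (induction I arbitrary: \<theta> rule: finite_induct)
  case (insert i I)
  let ?G = "Gcd (a ` I)"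
  obtain u v :: int where uv: "u * int (a i) + v * int ?G = gcd (int (a i)) (int ?G)"
    using bezout_int by blast
  define \<theta>' where "\<theta>' = \<theta> powi v"
  have "\<theta>' \<noteq> 0" using insert.prems by (simp add: \<theta>'_def)
  then obtain \<mu> where \<mu>: "\<forall>i\<in>I. \<mu> i \<noteq> 0" "(\<Prod>i\<in>I. \<mu> i ^ a i) = \<theta>' ^ ?G"
    using insert.IH by blast
  define \<mu>' where "\<mu>' = \<mu>(i := \<theta> powi u)"
  have "(\<Prod>j\<in>I. \<mu>' j ^ a j) = (\<Prod>j\<in>I. \<mu> j ^ a j)"
    by (rule prod.cong) (use insert.hyps in \<open>auto simp: \<mu>'_def\<close>)
  then have "(\<Prod>j\<in>insert i I. \<mu>' j ^ a j) = (\<theta> powi u) ^ a i * (\<theta> powi v) ^ ?G"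
    using insert.hyps \<mu>(2) by (simp add: \<mu>'_def \<theta>'_def)
  also have "\<dots> = \<theta> powi (u * int (a i)) * \<theta> powi (v * int ?G)"
    by (simp add: power_int_mult)
  also have "\<dots> = \<theta> powi (u * int (a i) + v * int ?G)"
    using insert.prems by (simp add: power_int_add)
  also have "\<dots> = \<theta> ^ Gcd (a ` insert i I)"
    unfolding uv by (simp flip: power_int_of_nat)
  finally have "(\<Prod>j\<in>insert i I. \<mu>' j ^ a j) = \<theta> ^ Gcd (a ` insert i I)" .
  moreover have "\<forall>j\<in>insert i I. \<mu>' j \<noteq> 0" using \<mu>(1) insert.prems by (simp add: \<mu>'_def)
  ultimately show ?case by blast
qed simp

context cyclic_decomposition
begin

lemma det_commuting_eq_power:
  assumes Y: "Y \<in> carrier_mat n n" "Y * M = M * Y"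
    and k: "k > 0" "\<And>i. i \<in> I \<Longrightarrow> k dvd a i"
  shows "\<exists>\<theta>. det Y = \<theta> ^ k"
proof -
  have "\<exists>p. Y *\<^sub>v act M (monom 1 t) (e i) = vsum n (\<lambda>j. act M (p j) (e j)) I" if "i \<in> I" for i t
    by (rule generates) (use Y that in simp)
  then have "\<forall>c. \<exists>p. fst c \<in> I \<longrightarrow>
      Y *\<^sub>v act M (monom 1 (snd c)) (e (fst c)) = vsum n (\<lambda>j. act M (p j) (e j)) I"
    by blast
  from choice[OF this] obtain P where P: "\<forall>c. fst c \<in> I \<longrightarrow>
      Y *\<^sub>v act M (monom 1 (snd c)) (e (fst c)) = vsum n (\<lambda>j. act M (P c j) (e j)) I"
    by (rule exE)
  define F where "F s = list_det (level s) (\<lambda>(j, r) c. coeff (P c j mod f j) r)" for s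
  have F: "F s = F (k * (s div k))" for s
  proof -
    \<comment> \<open>Because a_i is a multiple of k, no part separates s from the start of its run
      of length k.\<close>
    have "s < a i \<longleftrightarrow> k * (s div k) < a i" if "i \<in> I" for i
    proof -
      obtain q where q: "a i = k * q" using k(2)[OF \<open>i \<in> I\<close>] by (rule dvdE)
      have "s < k * q \<longleftrightarrow> s div k < q"
        using k(1) by (simp add: div_less_iff_less_mult mult.commute)
      then show ?thesis using q k(1) by simp
    qed
    then have "level s = level (k * (s div k))"
      unfolding level_def by (intro arg_cong[of _ _ concat] map_cong filter_cong) (auto simp: indices)
    then show ?thesis by (simp add: F_def)
  qed
  have empty: "F s = 1" if "s \<ge> height" for s
  proof -
    have "level s = []"
      using that a_le_height unfolding level_def by (fastforce simp: filter_empty_conv indices)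
    then show ?thesis by (simp add: F_def)
  qed
  have "det Y = (\<Prod>s<height. F s)"
    unfolding F_def by (rule det_commuting[OF Y]) (use P in simp)
  \<comment> \<open>Padding with factors 1 makes the range consist of complete runs of length
    k.\<close>
  also have "\<dots> = (\<Prod>s<height * k. F s)"
    using k(1) empty by (intro prod.mono_neutral_left) (auto simp: less_le_trans)
  also have "\<dots> = (\<Prod>m<height. \<Prod>s\<in>{m * k..<m * k + k}. F s)"
    by (rule prod.nat_group[symmetric])
  also have "\<dots> = (\<Prod>m<height. F (k * m) ^ k)"
  proof (rule prod.cong[OF refl])
    fix m
    have "F s = F (k * m)" if "s \<in> {m * k..<m * k + k}" for s
    proof -
      have "s div k = m" using that k(1) by (intro div_nat_eqI) (auto simp: algebra_simps)
      then show ?thesis using F[of s] by simp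
    qed
    then have "(\<Prod>s\<in>{m * k..<m * k + k}. F s) = (\<Prod>s\<in>{m * k..<m * k + k}. F (k * m))"
      by (rule prod.cong[OF refl])
    then show "(\<Prod>s\<in>{m * k..<m * k + k}. F s) = F (k * m) ^ k" by simp
  qed
  also have "\<dots> = (\<Prod>m<height. F (k * m)) ^ k" by (rule prod_power_distrib[symmetric])
  finally show ?thesis by blast
qed

text \<open>Multiplication by g_i on the i-th summand. It is built first as a K[x]-linear map on
  vectors and then turned into a matrix through its values on unit vectors; linearity for the
  polynomial x gives commutation with M.\<close>

lemma diagonal_endomorphism:
  "\<exists>Y\<in>carrier_mat n n. Y * M = M * Y \<and>
    (\<forall>p. Y *\<^sub>v vsum n (\<lambda>i. act M (p i) (e i)) I = vsum n (\<lambda>i. act M (g i * p i) (e i)) I)"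
proof -
  have "\<forall>v. \<exists>p. v \<in> carrier_vec n \<longrightarrow> v = vsum n (\<lambda>i. act M (p i) (e i)) I" using generates by blast
  from choice[OF this] obtain p
    where p: "\<forall>v. v \<in> carrier_vec n \<longrightarrow> v = vsum n (\<lambda>i. act M (p v i) (e i)) I" by (rule exE)
  define T where "T v = vsum n (\<lambda>i. act M (g i * p v i) (e i)) I" for v
  \<comment> \<open>The value does not depend on the chosen coefficients: two choices differ by
    multiples of f_i^(a_i), which kill e_i.\<close>
  have T: "T v = vsum n (\<lambda>i. act M (g i * q i) (e i)) I" if "v = vsum n (\<lambda>i. act M (q i) (e i)) I" for v q
    unfolding T_def
  proof (rule vsum_cong[OF refl act_e_cong])
    fix i assume i: "i \<in> I"
    have "v \<in> carrier_vec n" using that by simp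
    then have "vsum n (\<lambda>i. act M (p v i) (e i)) I = vsum n (\<lambda>i. act M (q i) (e i)) I"
      using p that by metis
    from independent_diff[OF this i] have "f i ^ a i dvd g i * (p v i - q i)" by (rule dvd_mult)
    then show "f i ^ a i dvd g i * p v i - g i * q i" by (simp add: right_diff_distrib)
  qed
  have T_carrier: "T v \<in> carrier_vec n" for v by (simp add: T_def)
  have T_add: "T (u + v) = T u + T v" if u: "u \<in> carrier_vec n" and v: "v \<in> carrier_vec n" for u v
  proof -
    have "u + v = vsum n (\<lambda>i. act M (p u i) (e i)) I + vsum n (\<lambda>i. act M (p v i) (e i)) I"
      using p u v by metis
    also have "\<dots> = vsum n (\<lambda>i. act M (p u i + p v i) (e i)) I"
      by (subst vsum_add[symmetric]) (auto simp: act_simps e_carrier intro!: vsum_cong)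
    finally have "T (u + v) = vsum n (\<lambda>i. act M (g i * (p u i + p v i)) (e i)) I" by (rule T)
    also have "\<dots> = vsum n (\<lambda>i. act M (g i * p u i) (e i) + act M (g i * p v i) (e i)) I"
      by (rule vsum_cong[OF refl]) (simp add: distrib_left act_add_left[OF M] e_carrier)
    also have "\<dots> = T u + T v" unfolding T_def by (rule vsum_add) auto
    finally show ?thesis .
  qed
  have T_act: "T (act M r v) = act M r (T v)" if v: "v \<in> carrier_vec n" for r v
  proof -
    have "act M r v = act M r (vsum n (\<lambda>i. act M (p v i) (e i)) I)" using p v by metis
    also have "\<dots> = vsum n (\<lambda>i. act M (r * p v i) (e i)) I"
      by (subst act_vsum[OF M finite_I]) (auto simp: act_mult[OF M] e_carrier intro!: vsum_cong)
    finally have "T (act M r v) = vsum n (\<lambda>i. act M (g i * (r * p v i)) (e i)) I" by (rule T)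
    also have "\<dots> = vsum n (\<lambda>i. act M r (act M (g i * p v i) (e i))) I"
      by (rule vsum_cong[OF refl]) (simp add: act_mult[OF M e_carrier, symmetric] mult.left_commute)
    also have "\<dots> = act M r (T v)"
      unfolding T_def by (rule act_vsum[OF M finite_I, symmetric]) simp
    finally show ?thesis .
  qed
  have T_zero: "T (0\<^sub>v n) = 0\<^sub>v n"
    using T_act[of "0\<^sub>v n" 0] by (simp add: act_zero_left[OF M] T_carrier)
  define Y where "Y = mat n n (\<lambda>(l, m). T (unit_vec n m) $ l)"
  have Y: "Y \<in> carrier_mat n n" by (simp add: Y_def)
  have YT: "Y *\<^sub>v v = T v" if v: "v \<in> carrier_vec n" for v
  proof -
    let ?w = "\<lambda>j. act M [:v $ j:] (unit_vec n j)"
    have "v = vsum n ?w {..<n}"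
      using v by (intro eq_vecI)
        (auto simp: act_const[OF M] if_distrib[of "\<lambda>x. _ * x"] unit_vec_def cong: if_cong)
    then have "T v = T (vsum n ?w {..<n})" by simp
    also have "\<dots> = vsum n (\<lambda>j. T (?w j)) {..<n}"
      by (rule vsum_additive) (use M T_add T_zero T_carrier in auto)
    also have "\<dots> = Y *\<^sub>v v"
    proof (rule eq_vecI)
      fix l assume "l < dim_vec (Y *\<^sub>v v)"
      then have l: "l < n" using Y by simp
      then show "vsum n (\<lambda>j. T (?w j)) {..<n} $ l = (Y *\<^sub>v v) $ l"
        using v by (simp add: T_act act_const[OF M T_carrier] carrier_vecD[OF T_carrier] Y_def
            scalar_prod_def lessThan_atLeast0 mult.commute)
    qed (use Y in simp)
    finally show ?thesis ..
  qed
  have "Y * M = M * Y"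
  proof (rule mat_eqI_mult_vec)
    fix v :: "'a vec" assume v: "v \<in> carrier_vec n"
    have "(Y * M) *\<^sub>v v = T (act M [:0, 1:] v)"
      using Y M v by (simp add: YT act_X[OF M v])
    also have "\<dots> = M *\<^sub>v T v" by (simp only: T_act[OF v] act_X[OF M T_carrier])
    also have "\<dots> = (M * Y) *\<^sub>v v" using Y M v by (simp add: YT)
    finally show "(Y * M) *\<^sub>v v = (M * Y) *\<^sub>v v" .
  qed (use Y M in auto)
  then show ?thesis using Y YT T by (intro bexI[of _ Y]) auto
qed

text \<open>The map keeps every summand, so each diagonal block splits further into multiplication
  by g_i on K[x]/(f_i). Summand i is present for s = 0, ..., a_i - 1, which explains the
  exponent.\<close>

lemma det_diagonal_endomorphism:
  "\<exists>Y\<in>carrier_mat n n. Y * M = M * Y \<and> det Y = (\<Prod>i\<in>I. det (mult_matrix (f i) (g i)) ^ a i)"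
proof -
  obtain Y where Y: "Y \<in> carrier_mat n n" "Y * M = M * Y"
    and act: "\<And>p. Y *\<^sub>v vsum n (\<lambda>i. act M (p i) (e i)) I = vsum n (\<lambda>i. act M (g i * p i) (e i)) I"
    using diagonal_endomorphism by blast
  define P where "P = (\<lambda>(i, t) j. g j * (if j = i then monom 1 t else 0))"
  have "det Y = (\<Prod>s<height. list_det (level s) (\<lambda>(j, r) c. coeff (P c j mod f j) r))"
  proof (rule det_commuting[OF Y])
    fix i t assume i: "i \<in> I"
    have "act M (monom 1 t) (e i) = vsum n (\<lambda>j. act M (if j = i then monom 1 t else 0) (e j)) I"
      using i finite_I by (subst vsum_single[of _ i]) (auto simp: act_zero_left[OF M] e_carrier)
    then show "Y *\<^sub>v act M (monom 1 t) (e i) = vsum n (\<lambda>j. act M (P (i, t) j) (e j)) I"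
      by (simp add: act P_def)
  qed
  also have "\<dots> = (\<Prod>s<height. \<Prod>i\<in>I. if s < a i then det (mult_matrix (f i) (g i)) else 1)"
  proof (rule prod.cong[OF refl])
    fix s
    let ?A = "\<lambda>(j, r) c. coeff (P c j mod f j) r"
    have "list_det (level s) ?A
        = (\<Prod>i\<in>set (filter (\<lambda>i. s < a i) indices). list_det (map (Pair i) [0..<degree (f i)]) ?A)"
      unfolding level_def
      by (rule list_det_concat_diagonal) (use indices in \<open>auto simp: P_def\<close>)
    also have "\<dots> = (\<Prod>i\<in>set (filter (\<lambda>i. s < a i) indices). det (mult_matrix (f i) (g i)))"
      by (intro prod.cong refl)
        (auto simp: list_det_map list_det_def mult_matrix_def P_def intro!: arg_cong[of _ _ det] eq_matI)
    also have "\<dots> = (\<Prod>i\<in>I. if s < a i then det (mult_matrix (f i) (g i)) else 1)"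
      using finite_I by (simp add: indices prod.inter_filter)
    finally show "list_det (level s) ?A = (\<Prod>i\<in>I. if s < a i then det (mult_matrix (f i) (g i)) else 1)" .
  qed
  also have "\<dots> = (\<Prod>i\<in>I. \<Prod>s<height. if s < a i then det (mult_matrix (f i) (g i)) else 1)"
    by (rule prod.swap)
  also have "\<dots> = (\<Prod>i\<in>I. det (mult_matrix (f i) (g i)) ^ a i)"
  proof (rule prod.cong[OF refl])
    fix i assume "i \<in> I"
    then have "{s\<in>{..<height}. s < a i} = {..<a i}" using a_le_height[of i] by auto
    then show "(\<Prod>s<height. if s < a i then det (mult_matrix (f i) (g i)) else 1)
        = det (mult_matrix (f i) (g i)) ^ a i"
      by (simp flip: prod.inter_filter)
  qed
  finally show ?thesis using Y by blast
qed

end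

theorem theorem3p1:
  fixes M :: "'a::finite_field mat" and n k :: nat
  assumes "M \<in> carrier_mat n n"
    and "has_part_size_invariant M k"
  shows "{det Y | Y. Y \<in> carrier_mat n n \<and> Y * M = M * Y} = {\<theta> ^ k | \<theta>. \<theta> \<in> (UNIV :: 'a set)}"
proof -
  obtain part where part: "\<And>f. f \<in> irreducible_factors M \<Longrightarrow> is_primary_partition M f (part f)"
    and k: "k = Gcd (\<Union>f\<in>irreducible_factors M. set (part f))"
    using assms(2) unfolding has_part_size_invariant_def by blast
  define I where "I = (SIGMA f:irreducible_factors M. {..<length (part f)})"
  define a where "a = (\<lambda>(f, j). part f ! j)"
  obtain e where "cyclic_decomposition M n I fst a e"
    using cyclic_decomposition_exists[OF assms(1) part] unfolding I_def a_def by blast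
  then interpret cyclic_decomposition M n I fst a e .
  have kI: "k = Gcd (a ` I)"
    unfolding k by (rule arg_cong[of _ _ Gcd]) (force simp: I_def a_def in_set_conv_nth image_iff)
  show ?thesis
  proof (cases "k = 0")
    case True
    \<comment> \<open>A greatest common divisor 0 would make all parts 0, but parts are positive.
      Both sides of the claim are then {1}, since the zeroth power of every element, 0 included, is
      1.\<close>
    then have "I = {}" using kI a_pos by (fastforce simp: Gcd_0_iff)
    then have "height = 0" unfolding height_def by simp
    then have det: "det Y = 1" if "Y \<in> carrier_mat n n" "Y * M = M * Y" for Y
      using det_commuting[OF that, of "\<lambda>_ _. 0"] \<open>I = {}\<close> by simp
    have "{det Y | Y. Y \<in> carrier_mat n n \<and> Y * M = M * Y} = {1}"
    proof (intro equalityI subsetI)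
      fix x :: 'a assume "x \<in> {1}"
      then show "x \<in> {det Y | Y. Y \<in> carrier_mat n n \<and> Y * M = M * Y}"
        using assms(1) by (intro CollectI exI[of _ "1\<^sub>m n"]) simp
    qed (use det in auto)
    then show ?thesis using True by simp
  next
    case False
    have "\<exists>Y. \<theta> ^ k = det Y \<and> Y \<in> carrier_mat n n \<and> Y * M = M * Y" for \<theta> :: 'a
    proof (cases "\<theta> = 0")
      case True
      have "I \<noteq> {}" using kI False by auto
      then obtain i where i: "i \<in> I" by blast
      \<comment> \<open>A basis label exists, so n is positive; the zero matrix then has determinant
        0 rather than the empty determinant 1.\<close>
      then have "((i, 0), 0) \<in> set basis_indices"
        using a_pos degree_irreducible_pos[OF f_irreducible] by (auto simp: set_basis_indices)
      then have "n > 0" using is_basis_invertible(1)[OF is_basis_basis_vector] by (cases n) auto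
      \<comment> \<open>As a multiple of the identity, the zero matrix has determinant 0^n.\<close>
      then have "det (0 \<cdot>\<^sub>m 1\<^sub>m n :: 'a mat) = 0" by simp
      then have "\<theta> ^ k = det (0 \<cdot>\<^sub>m 1\<^sub>m n :: 'a mat)" using True \<open>k \<noteq> 0\<close> by (simp only: power_0_left if_False)
      moreover have "(0 \<cdot>\<^sub>m 1\<^sub>m n) * M = M * (0 \<cdot>\<^sub>m 1\<^sub>m n)" using assms(1) by (intro eq_matI) auto
      ultimately show ?thesis by (intro exI[of _ "0 \<cdot>\<^sub>m 1\<^sub>m n"] conjI) simp_all
    next
      case False
      obtain \<mu> where \<mu>: "\<forall>i\<in>I. \<mu> i \<noteq> 0" "(\<Prod>i\<in>I. \<mu> i ^ a i) = \<theta> ^ k"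
        using power_product_eq_power_Gcd[OF finite_I False] kI by blast
      have "\<forall>i\<in>I. \<exists>g. det (mult_matrix (fst i) g) = \<mu> i"
        using det_mult_matrix_surj f_irreducible f_monic \<mu>(1) by blast
      from bchoice[OF this] obtain g where g: "\<forall>i\<in>I. det (mult_matrix (fst i) (g i)) = \<mu> i" by (rule exE)
      obtain Y where "Y \<in> carrier_mat n n" "Y * M = M * Y"
        "det Y = (\<Prod>i\<in>I. det (mult_matrix (fst i) (g i)) ^ a i)"
        using det_diagonal_endomorphism by blast
      moreover have "(\<Prod>i\<in>I. det (mult_matrix (fst i) (g i)) ^ a i) = \<theta> ^ k"
        using g \<mu>(2) by simp
      ultimately show ?thesis by (intro exI[of _ Y]) simp
    qed
    moreover have "\<exists>\<theta>. det Y = \<theta> ^ k" if "Y \<in> carrier_mat n n" "Y * M = M * Y" for Y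
    proof (rule det_commuting_eq_power[OF that])
      show "k dvd a i" if "i \<in> I" for i unfolding kI using that by (intro Gcd_dvd imageI)
    qed (use False in simp)
    ultimately show ?thesis by blast
  qed
qed

end
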